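(* Let $k\in\{1,2,3,4\}$, let $G$ be a finite simple graph, and let $X\subseteq V(G)$ with $\kappa_G(X)\ge k$. Then: (i) $G$ has a $k$-connected $X$-minor. (ii) If $1\le k\le 3$, then $G$ has a $k$-connected topological $X$-minor.
   Context: All graphs are finite, simple and undirected. A set $S\subset V(G)$ is an $X$-separator of $G$ if at least two components of $G-S$ contain a vertex of $X$. $\kappa_G(X)$ denotes the maximum integer less than or equal to $|X|-1$ such that every $X$-separator of $G$ (if any exists) has cardinality at least $\kappa_G(X)$; $G$ is $k$-connected if $\kappa_G(V(G))\ge k$. For adjacent vertices $x,y$, $G/xy$ is the graph obtained from $G$ by deleting $y$ and adding an edge $xz$ for every $z$ with $yz\in E(G)$ and $xz\notin E(G)$ (the edge is contracted into $x$, which keeps its name). An edge $xy$ is $X$-legal if $y\notin X$. A graph $M$ is an $X$-minor of $G$ (minor rooted at $X$) if it can be obtained from a subgraph of $G$ containing $X$ by a (possibly empty) sequence of contractions of $X$-legal edges (so $X\subseteq V(M)\subseteq V(G)$). An $X$-minor $M$ of $G$ is a topological $X$-minor if there is an isomorphism from a subdivision of $M$ onto a subgraph of $G$ fixing all vertices of $M$. *)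

theory Defs
  imports "Graph_Theory.Graph_Theory"
begin

text \<open>
  A finite simple undirected graph is a \<^locale>\<open>pair_graph\<close>: a finite vertex set together with
  a symmetric irreflexive relation on it, an edge xy being the two arcs (x, y) and (y, x).
  Such a graph being symmetric, its strongly connected components \<^const>\<open>pre_digraph.sccs\<close>
  are its connected components.
\<close>

definition separator :: "'a pair_pre_digraph \<Rightarrow> 'a set \<Rightarrow> 'a set \<Rightarrow> bool" where
  "separator G X S \<longleftrightarrow> S \<subseteq> pverts G \<and>
     (\<exists>C \<in> pre_digraph.sccs (with_proj G \<restriction> (pverts G - S)).
      \<exists>D \<in> pre_digraph.sccs (with_proj G \<restriction> (pverts G - S)).
        C \<noteq> D \<and> verts C \<inter> X \<noteq> {} \<and> verts D \<inter> X \<noteq> {})"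

text \<open>The value is an integer because it is -1 for X empty.\<close>

definition kappa :: "'a pair_pre_digraph \<Rightarrow> 'a set \<Rightarrow> int" where
  "kappa G X = (GREATEST j. j \<le> int (card X) - 1 \<and>
     (\<forall>S. separator G X S \<longrightarrow> j \<le> int (card S)))"

definition k_connected :: "nat \<Rightarrow> 'a pair_pre_digraph \<Rightarrow> bool" where
  "k_connected k G \<longleftrightarrow> pair_graph G \<and> int k \<le> kappa G (pverts G)"

text \<open>
  The edge xy is contracted into x, which keeps its name. The condition on z excludes only the
  loop at x that the edge xy itself would produce; edges xz already present are absorbed by the
  union.
\<close>

definition contract :: "'a pair_pre_digraph \<Rightarrow> 'a \<Rightarrow> 'a \<Rightarrow> 'a pair_pre_digraph" where
  "contract G x y = \<lparr>
     pverts = pverts G - {y},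
     parcs = {e \<in> parcs G. fst e \<noteq> y \<and> snd e \<noteq> y}
       \<union> {(x, z) | z. (y, z) \<in> parcs G \<and> z \<noteq> x}
       \<union> {(z, x) | z. (y, z) \<in> parcs G \<and> z \<noteq> x}\<rparr>"

inductive rooted_minor :: "'a set \<Rightarrow> 'a pair_pre_digraph \<Rightarrow> 'a pair_pre_digraph \<Rightarrow> bool"
  for X :: "'a set" and G :: "'a pair_pre_digraph" where
  subgraph: "\<lbrakk>pair_graph H; subgraph (with_proj H) (with_proj G); X \<subseteq> pverts H\<rbrakk>
    \<Longrightarrow> rooted_minor X G H"
| contract: "\<lbrakk>rooted_minor X G M; (x, y) \<in> parcs M; y \<notin> X\<rbrakk>
    \<Longrightarrow> rooted_minor X G (contract M x y)"

text \<open>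
  The subdivision D of M may use vertices outside G. Taking them in the vertex type of G loses no
  generality: D has as many vertices as its image in G, so it can be renamed within that type.
\<close>

definition topological_rooted_minor ::
  "'a set \<Rightarrow> 'a pair_pre_digraph \<Rightarrow> 'a pair_pre_digraph \<Rightarrow> bool" where
  "topological_rooted_minor X G M \<longleftrightarrow> rooted_minor X G M \<and>
     (\<exists>(D :: 'a pair_pre_digraph) f. subdivision_pair M D
        \<and> pre_digraph.digraph_isomorphism (with_proj D) f
        \<and> subgraph (app_iso f (with_proj D)) (with_proj G)
        \<and> (\<forall>v \<in> pverts M. iso_verts f v = v))"

end

theory Submission
  imports Defs
begin

text \<open>
  Write N(K) for the set of vertices outside K with a neighbour in K. If X is k-linked in G but G
  is not k-connected, then there is a nonempty set K of vertices that avoids X and has fewer than k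
  vertices in N(K). Replacing K by a clique on N(K) (the torso) keeps X linked, so it suffices to
  realise this replacement, or some other smaller linked graph, by deletions and contractions, and
  to induct on the size of G.

  If N(K) has at most two vertices and no proper subgraph of G is linked, a smallest such K is a
  single vertex of degree two with nonadjacent neighbours. Suppressing that vertex is inverse to a
  subdivision. This settles k at most 3 and yields a topological minor.

  Let k = 4 and let G be minimal. Every set K as above has three vertices in N(K), and a
  contraction argument shows that the torso is a rooted minor unless K is a single vertex v with
  independent neighbourhood a, b, c. If X is not linked after contracting va, then G - v has a
  separator with three vertices, among them a, that separates b from c and splits X; likewise with
  a and b exchanged. Of the four quadrants of these two separations, those that are bounded by at
  most three vertices avoid X and hence have at most one vertex. Counting the vertices of the two
  separators then always yields a vertex of X with at most three neighbours or a side without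
  vertices of X.
\<close>

section \<open>Finite simple graphs as pairs of vertex and arc sets\<close>

lemma pair_graph_iff:
  "pair_graph G \<longleftrightarrow> finite (pverts G) \<and> parcs G \<subseteq> pverts G \<times> pverts G \<and>
     sym (parcs G) \<and> irrefl (parcs G)"
proof
  assume "pair_graph G"
  then interpret pair_graph G .
  show "finite (pverts G) \<and> parcs G \<subseteq> pverts G \<times> pverts G \<and> sym (parcs G) \<and> irrefl (parcs G)"
    using pair_finite_verts arc_fst_in_verts arc_snd_in_verts arcs_symmetric no_loops'
    by (fastforce simp: sym_def irrefl_def)
next
  assume A: "finite (pverts G) \<and> parcs G \<subseteq> pverts G \<times> pverts G \<and> sym (parcs G) \<and> irrefl (parcs G)"
  then have "finite (parcs G)"
    by (intro finite_subset[of "parcs G" "pverts G \<times> pverts G"]) simp_all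
  with A show "pair_graph G"
    by unfold_locales (auto simp: irrefl_def symmetric_def)
qed

lemma parcs_sym: "pair_graph G \<Longrightarrow> (u, v) \<in> parcs G \<longleftrightarrow> (v, u) \<in> parcs G"
  by (auto simp: pair_graph_iff sym_def)

lemma parcs_irrefl: "pair_graph G \<Longrightarrow> (u, u) \<notin> parcs G"
  by (auto simp: pair_graph_iff irrefl_def)

lemma parcs_in_pverts: "pair_graph G \<Longrightarrow> (u, v) \<in> parcs G \<Longrightarrow> u \<in> pverts G \<and> v \<in> pverts G"
  by (auto simp: pair_graph_iff)

lemma finite_pverts: "pair_graph G \<Longrightarrow> finite (pverts G)"
  by (simp add: pair_graph_iff)

lemma finite_parcs: "pair_graph G \<Longrightarrow> finite (parcs G)"
  by (rule finite_subset[of _ "pverts G \<times> pverts G"]) (simp_all add: pair_graph_iff)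

lemma subgraph_with_proj_iff:
  assumes "pair_graph H" "pair_graph G"
  shows "subgraph (with_proj H) (with_proj G) \<longleftrightarrow> pverts H \<subseteq> pverts G \<and> parcs H \<subseteq> parcs G"
proof -
  have "wf_digraph (with_proj H)" "wf_digraph (with_proj G)"
    using assms unfolding wf_digraph_wp_iff
    by (auto simp: pair_graph_iff intro!: pair_wf_digraph.intro)
  then show ?thesis
    by (auto simp: subgraph_def compatible_def)
qed

text \<open>Contractions and torsos of nonempty sets lose vertices, whereas a proper subgraph may
  lose only arcs. The lexicographic measure admits all these reductions in one induction.\<close>

lemma pair_graph_size_induct [case_names less]:
  assumes "\<And>G. (\<And>H. card (pverts H) < card (pverts G) \<or>
      pverts H = pverts G \<and> card (parcs H) < card (parcs G) \<Longrightarrow> P H) \<Longrightarrow> P G"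
  shows "P (G :: 'a pair_pre_digraph)"
proof (induct G rule: wf_induct_rule[OF wf_measures[of "[\<lambda>G. card (pverts G), \<lambda>G. card (parcs G)]"]])
  case (1 G)
  show ?case
  proof (rule assms)
    fix H :: "'a pair_pre_digraph" assume "card (pverts H) < card (pverts G) \<or>
      pverts H = pverts G \<and> card (parcs H) < card (parcs G)"
    then show "P H"
      by (intro 1) auto
  qed
qed

lemma smaller_subgraph:
  assumes "pair_graph G" "pverts H \<subseteq> pverts G" "parcs H \<subseteq> parcs G" "H \<noteq> G"
  shows "card (pverts H) < card (pverts G) \<or>
    pverts H = pverts G \<and> card (parcs H) < card (parcs G)"
proof (cases "pverts H = pverts G")
  case True
  then have "parcs H \<subset> parcs G"
    using assms by (auto intro: pair_pre_digraph.equality)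
  then show ?thesis
    using True finite_parcs[OF assms(1)] by (simp add: psubset_card_mono)
next
  case False
  then show ?thesis
    using assms finite_pverts[OF assms(1)] by (simp add: psubset_card_mono psubset_eq)
qed

definition nbs :: "'a pair_pre_digraph \<Rightarrow> 'a set \<Rightarrow> 'a set" where
  "nbs G A = parcs G `` A - A"

lemma nbs_iff: "z \<in> nbs G A \<longleftrightarrow> z \<notin> A \<and> (\<exists>y\<in>A. (y, z) \<in> parcs G)"
  by (auto simp: nbs_def)

lemma nbs_in_pverts: "pair_graph G \<Longrightarrow> nbs G A \<subseteq> pverts G"
  by (auto simp: nbs_iff dest: parcs_in_pverts)

lemma finite_nbs: "pair_graph G \<Longrightarrow> finite (nbs G A)"
  using finite_subset[OF nbs_in_pverts finite_pverts] .

section \<open>Local connectivity through neighbourhoods\<close>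

text \<open>Quantifying over arbitrary vertex sets A in place of components of G - S lets unions,
  intersections and complements be tested directly. A violating A makes N(A) a separator of X with
  fewer than k vertices.\<close>

definition linked :: "nat \<Rightarrow> 'a pair_pre_digraph \<Rightarrow> 'a set \<Rightarrow> bool" where
  "linked k G X \<longleftrightarrow> k < card X \<and>
     (\<forall>A \<subseteq> pverts G. A \<inter> X \<noteq> {} \<longrightarrow> X \<subseteq> A \<union> nbs G A \<or> k \<le> card (nbs G A))"

lemma le_kappa_iff:
  "int k \<le> kappa G X \<longleftrightarrow> k < card X \<and> (\<forall>S. separator G X S \<longrightarrow> k \<le> card S)"
proof -
  let ?P = "\<lambda>j. j \<le> int (card X) - 1 \<and> (\<forall>S. separator G X S \<longrightarrow> j \<le> int (card S))"
  \<comment> \<open>The shift j = n - 1 turns the maximum over the integers from -1 on into a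
    bounded maximum over the naturals; n = 0 always qualifies.\<close>
  let ?Q = "\<lambda>n. ?P (int n - 1)"
  have ex: "?Q 0"
    by auto
  have bd: "\<And>n. ?Q n \<Longrightarrow> n \<le> card X"
    by auto
  define m where "m = (GREATEST n. ?Q n)"
  have m: "?Q m"
    unfolding m_def by (rule GreatestI_nat[of ?Q 0 "card X", OF ex bd])
  have mx: "n \<le> m" if "?Q n" for n
    unfolding m_def by (rule Greatest_le_nat[of ?Q n "card X", OF that bd])
  have mx': "j \<le> int m - 1" if "?P j" for j
  proof (cases "j < 0")
    case False
    then have "?Q (nat (j + 1))"
      using that by simp
    from mx[OF this] show ?thesis
      using False by linarith
  qed simp
  have "kappa G X = int m - 1"
    unfolding kappa_def using m mx' by (intro Greatest_equality) auto
  moreover have "int k \<le> int m - 1 \<longleftrightarrow> ?P (int k)"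
  proof
    assume "int k \<le> int m - 1"
    then show "?P (int k)"
      using m by fastforce
  qed (use mx' in blast)
  ultimately show ?thesis
    by auto
qed

lemma induce_with_proj_pair_graph:
  assumes "pair_graph G" "W \<subseteq> pverts G"
  shows "sym_digraph (with_proj G \<restriction> W)"
proof -
  interpret pair_graph G by fact
  have "symmetric (with_proj G \<restriction> W)"
    using assms(2) by (intro induced_graph_imp_symmetric[OF sym_arcs] induced_induce)
  then show ?thesis
    by (intro sym_digraph.intro sym_digraph_axioms.intro wellformed_induce_subgraph)
qed

lemma adj_induce_iff:
  "u \<rightarrow>\<^bsub>with_proj G \<restriction> W\<^esub> v \<longleftrightarrow> (u, v) \<in> parcs G \<and> u \<in> W \<and> v \<in> W"
  by (force simp: arcs_ends_conv)

text \<open>A component C of G - S that meets X has N(C) inside S and misses the X-vertices of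
  another such component. Conversely, if A violates the neighbourhood condition, paths in G - N(A)
  that start in A stay in A, so N(A) separates X.\<close>

lemma linked_iff_kappa:
  assumes G: "pair_graph G" and X: "X \<subseteq> pverts G"
  shows "linked k G X \<longleftrightarrow> int k \<le> kappa G X"
proof -
  have "(\<forall>A \<subseteq> pverts G. A \<inter> X \<noteq> {} \<longrightarrow> X \<subseteq> A \<union> nbs G A \<or> k \<le> card (nbs G A))
    \<longleftrightarrow> (\<forall>S. separator G X S \<longrightarrow> k \<le> card S)" (is "?L \<longleftrightarrow> ?R")
  proof
    assume L: ?L
    show ?R
    proof (intro allI impI)
      fix S assume sep: "separator G X S"
      define H where "H = with_proj G \<restriction> (pverts G - S)"
      interpret H: sym_digraph H
        unfolding H_def using G by (intro induce_with_proj_pair_graph) auto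
      from sep obtain C D where S: "S \<subseteq> pverts G" and CD: "C \<in> H.sccs" "D \<in> H.sccs" "C \<noteq> D"
        "verts C \<inter> X \<noteq> {}" "verts D \<inter> X \<noteq> {}"
        unfolding separator_def H_def by auto
      have Cv: "verts C \<in> H.sccs_verts" and Dv: "verts D \<in> H.sccs_verts"
        using CD by (auto intro: H.in_sccs_vertsI_sccs)
      have ne: "verts C \<noteq> verts D"
        using CD H.inj_on_verts_sccs by (auto dest: inj_onD)
      have disj: "verts C \<inter> verts D = {}"
        using H.sccs_verts_disjoint[OF Cv Dv ne] .
      have CW: "verts C \<subseteq> pverts G - S" "verts D \<subseteq> pverts G - S"
        using H.sccs_verts_subsets[OF Cv] H.sccs_verts_subsets[OF Dv] by (auto simp: H_def)
      have nS: "nbs G (verts C) \<subseteq> S"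
      proof
        fix z assume "z \<in> nbs G (verts C)"
        then obtain y where y: "z \<notin> verts C" "y \<in> verts C" "(y, z) \<in> parcs G"
          by (auto simp: nbs_iff)
        show "z \<in> S"
        proof (rule ccontr)
          assume "z \<notin> S"
          then have "y \<rightarrow>\<^bsub>H\<^esub> z"
            using y CW parcs_in_pverts[OF G y(3)] by (auto simp: H_def adj_induce_iff)
          then have "y \<rightarrow>\<^sup>*\<^bsub>H\<^esub> z" "z \<rightarrow>\<^sup>*\<^bsub>H\<^esub> y"
            using H.symmetric_reachable' by auto
          then show False
            using Cv y unfolding H.in_sccs_verts_conv_reachable by blast
        qed
      qed
      have "\<not> X \<subseteq> verts C \<union> nbs G (verts C)"
        using CD CW nS disj by blast
      then have "k \<le> card (nbs G (verts C))"
        using L CD CW by blast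
      also have "\<dots> \<le> card S"
        using nS S finite_pverts[OF G] finite_subset by (metis card_mono)
      finally show "k \<le> card S" .
    qed
  next
    assume R: ?R
    show ?L
    proof (intro allI impI)
      fix A assume A: "A \<subseteq> pverts G" "A \<inter> X \<noteq> {}"
      show "X \<subseteq> A \<union> nbs G A \<or> k \<le> card (nbs G A)"
      proof (rule disjCI)
        assume "\<not> k \<le> card (nbs G A)"
        then have ns: "\<not> separator G X (nbs G A)"
          using R by blast
        define H where "H = with_proj G \<restriction> (pverts G - nbs G A)"
        interpret H: sym_digraph H
          unfolding H_def using G by (intro induce_with_proj_pair_graph) auto
        obtain x where x: "x \<in> A" "x \<in> X"
          using A by auto
        show "X \<subseteq> A \<union> nbs G A"
        proof (rule ccontr)
          assume "\<not> X \<subseteq> A \<union> nbs G A"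
          then obtain x' where x': "x' \<in> X" "x' \<notin> A" "x' \<notin> nbs G A"
            by auto
          let ?C = "H \<restriction> {v. x \<rightarrow>\<^sup>*\<^bsub>H\<^esub> v}" and ?D = "H \<restriction> {v. x' \<rightarrow>\<^sup>*\<^bsub>H\<^esub> v}"
          have xv: "x \<in> verts H" "x' \<in> verts H"
            using x x' X by (auto simp: H_def nbs_iff)
          have stay: "v \<in> A" if "x \<rightarrow>\<^sup>*\<^bsub>H\<^esub> v" for v
            using that
          proof (induct rule: H.reachable_induct)
            case base then show ?case using x by simp
          next
            case (step u v)
            then show ?case
              by (auto simp: H_def adj_induce_iff nbs_iff)
          qed
          have "?C \<in> H.sccs" "?D \<in> H.sccs"
            using xv by (auto intro: H.induce_reachable_is_in_sccs)
          moreover have "?C \<noteq> ?D"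
          proof
            assume "?C = ?D"
            then have "verts ?C = verts ?D"
              by simp
            then have "x \<rightarrow>\<^sup>*\<^bsub>H\<^esub> x'"
              using xv by auto
            then show False
              using stay x' by blast
          qed
          moreover have "verts ?C \<inter> X \<noteq> {}" "verts ?D \<inter> X \<noteq> {}"
            using x x' xv by auto
          ultimately have "separator G X (nbs G A)"
            using nbs_in_pverts[OF G] unfolding separator_def H_def[symmetric] by blast
          then show False
            using ns by blast
        qed
      qed
    qed
  qed
  then show ?thesis
    unfolding linked_def le_kappa_iff by blast
qed

section \<open>Rooted minors\<close>

lemma pverts_contract [simp]: "pverts (contract G x y) = pverts G - {y}"
  by (simp add: contract_def)

lemma parcs_contract_iff:
  "(u, v) \<in> parcs (contract G x y) \<longleftrightarrow> (u, v) \<in> parcs G \<and> u \<noteq> y \<and> v \<noteq> y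
     \<or> u = x \<and> v \<noteq> x \<and> (y, v) \<in> parcs G \<or> v = x \<and> u \<noteq> x \<and> (y, u) \<in> parcs G"
  by (auto simp: contract_def)

lemma pair_graph_contract:
  assumes "pair_graph G" "(x, y) \<in> parcs G"
  shows "pair_graph (contract G x y)"
  using assms unfolding pair_graph_iff
  by (auto simp: parcs_contract_iff sym_def irrefl_def)

lemma rooted_minor_pair_graph: "rooted_minor X G M \<Longrightarrow> pair_graph M \<and> X \<subseteq> pverts M"
  by (induct rule: rooted_minor.induct) (auto intro: pair_graph_contract)

lemma rooted_minor_of_subgraph:
  assumes "pair_graph G" "pair_graph H" "pverts H \<subseteq> pverts G" "parcs H \<subseteq> parcs G" "X \<subseteq> pverts H"
  shows "rooted_minor X G H"
  using assms by (intro rooted_minor.subgraph) (auto simp: subgraph_with_proj_iff)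

lemma rooted_minor_refl: "pair_graph G \<Longrightarrow> X \<subseteq> pverts G \<Longrightarrow> rooted_minor X G G"
  by (auto intro: rooted_minor_of_subgraph)

text \<open>Deletions come first in \<open>rooted_minor\<close>; allowing them at the end as well is
  what makes the relation transitive. A subgraph of a contraction is either a subgraph of the
  original graph or the contraction of one.\<close>

lemma rooted_minor_subgraph:
  assumes "rooted_minor X G M" "pair_graph H" "pverts H \<subseteq> pverts M" "parcs H \<subseteq> parcs M"
    "X \<subseteq> pverts H"
  shows "rooted_minor X G H"
  using assms
proof (induct arbitrary: H rule: rooted_minor.induct)
  case (subgraph H')
  then have "subgraph (with_proj H) (with_proj H')"
    by (simp add: subgraph_with_proj_iff)
  then show ?case
    using subgraph by (meson rooted_minor.subgraph subgraph_trans)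
next
  case (contract M x y)
  have M: "pair_graph M"
    using contract rooted_minor_pair_graph by blast
  have arcs: "(u, v) \<in> parcs M \<and> u \<noteq> y \<and> v \<noteq> y \<or> u = x \<and> v \<noteq> x \<and> (y, v) \<in> parcs M
      \<or> v = x \<and> u \<noteq> x \<and> (y, u) \<in> parcs M" if "(u, v) \<in> parcs H" for u v
    using that contract.prems(3) by (metis parcs_contract_iff subsetD)
  note H = parcs_sym[OF contract.prems(1)] parcs_in_pverts[OF contract.prems(1)]
    parcs_irrefl[OF contract.prems(1)]
  show ?case
  proof (cases "x \<in> pverts H")
    case False
    have "parcs H \<subseteq> parcs M"
    proof
      fix e assume e: "e \<in> parcs H"
      obtain u v where uv: "e = (u, v)" by (cases e)
      then have "u \<noteq> x" "v \<noteq> x"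
        using False H(2) e by auto
      then show "e \<in> parcs M"
        using arcs e uv by blast
    qed
    then show ?thesis
      using contract by auto
  next
    case True
    \<comment> \<open>\<open>M'\<close> is \<open>H\<close> pulled back through the contraction: y
      returns, adjacent to x and to those of its old neighbours z for which xz is in
      \<open>H\<close>. Contracting xy in \<open>M'\<close> then restores \<open>H\<close>.\<close>
    define M' where "M' = \<lparr>pverts = insert y (pverts H), parcs = (parcs H \<inter> parcs M)
      \<union> {(x, y), (y, x)} \<union> {(y, z) |z. (y, z) \<in> parcs M \<and> (x, z) \<in> parcs H}
      \<union> {(z, y) |z. (y, z) \<in> parcs M \<and> (x, z) \<in> parcs H}\<rparr>"
    have in_M': "(u, v) \<in> parcs M' \<longleftrightarrow> (u, v) \<in> parcs H \<and> (u, v) \<in> parcs M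
      \<or> u = x \<and> v = y \<or> u = y \<and> v = x \<or> u = y \<and> (y, v) \<in> parcs M \<and> (x, v) \<in> parcs H
      \<or> v = y \<and> (y, u) \<in> parcs M \<and> (x, u) \<in> parcs H" for u v
      by (auto simp: M'_def)
    have y: "y \<notin> pverts H"
      using contract.prems by auto
    have xy: "x \<noteq> y"
      using True y by auto
    have yH: "(u, y) \<notin> parcs H" "(y, u) \<notin> parcs H" for u
      using H(2) y by auto
    have symH: "(v, u) \<in> parcs H" if "(u, v) \<in> parcs H" for u v
      using that H(1) by simp
    have "pair_graph M'"
      unfolding pair_graph_iff
    proof (intro conjI)
      show "finite (pverts M')"
        using contract.prems(1) by (simp add: M'_def finite_pverts)
      show "parcs M' \<subseteq> pverts M' \<times> pverts M'"
        using True H(2) by (auto simp: in_M') (auto simp: M'_def)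
      show "sym (parcs M')"
        using parcs_sym[OF M] H(1) by (auto simp: sym_def in_M')
      show "irrefl (parcs M')"
        using parcs_irrefl[OF M] xy by (auto simp: irrefl_def in_M')
    qed
    moreover have "pverts M' \<subseteq> pverts M"
      using contract.prems parcs_in_pverts[OF M contract.hyps(3)] by (auto simp: M'_def)
    moreover have "parcs M' \<subseteq> parcs M"
      using contract.hyps(3) parcs_sym[OF M] by (auto simp: in_M')
    moreover have "X \<subseteq> pverts M'"
      using contract.prems by (auto simp: M'_def)
    ultimately have "rooted_minor X G M'"
      using contract.hyps(2) by blast
    moreover have "(x, y) \<in> parcs M'"
      by (simp add: in_M')
    ultimately have "rooted_minor X G (contract M' x y)"
      using contract.hyps by (blast intro: rooted_minor.contract)
    moreover have "contract M' x y = H"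
    proof (rule pair_pre_digraph.equality)
      show "pverts (contract M' x y) = pverts H"
        using y by (auto simp: M'_def)
      have "(u, v) \<in> parcs (contract M' x y) \<longleftrightarrow> (u, v) \<in> parcs H" for u v
      proof
        assume "(u, v) \<in> parcs (contract M' x y)"
        then show "(u, v) \<in> parcs H"
          using xy yH by (auto simp: parcs_contract_iff in_M' intro: symH)
      next
        assume uv: "(u, v) \<in> parcs H"
        then have "u \<noteq> y" "v \<noteq> y"
          using y H(2) by auto
        then show "(u, v) \<in> parcs (contract M' x y)"
          using arcs[OF uv] uv symH[OF uv] by (auto simp: parcs_contract_iff in_M')
      qed
      then show "parcs (contract M' x y) = parcs H"
        by auto
    qed simp
    ultimately show ?thesis
      by simp
  qed
qed

lemma rooted_minor_trans:
  assumes "rooted_minor X H M" "rooted_minor X G H"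
  shows "rooted_minor X G M"
  using assms
proof (induct rule: rooted_minor.induct)
  case (subgraph H')
  then have "pair_graph H"
    using rooted_minor_pair_graph by blast
  with subgraph show ?case
    by (intro rooted_minor_subgraph[OF subgraph.prems]) (simp_all add: subgraph_with_proj_iff)
qed (auto intro: rooted_minor.contract)

lemma rooted_minor_contract:
  assumes "pair_graph G" "X \<subseteq> pverts G" "(x, y) \<in> parcs G" "y \<notin> X"
  shows "rooted_minor X G (contract G x y)"
  using assms by (auto intro: rooted_minor.contract rooted_minor_refl)

section \<open>Replacing an X-free set by a clique\<close>

definition torso :: "'a pair_pre_digraph \<Rightarrow> 'a set \<Rightarrow> 'a pair_pre_digraph" where
  "torso G K = \<lparr>
     pverts = pverts G - K,
     parcs = {e \<in> parcs G. fst e \<notin> K \<and> snd e \<notin> K}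
       \<union> {(s, t). s \<in> nbs G K \<and> t \<in> nbs G K \<and> s \<noteq> t}\<rparr>"

lemma pverts_torso [simp]: "pverts (torso G K) = pverts G - K"
  by (simp add: torso_def)

lemma parcs_torso_iff:
  "(u, v) \<in> parcs (torso G K) \<longleftrightarrow> (u, v) \<in> parcs G \<and> u \<notin> K \<and> v \<notin> K
     \<or> u \<in> nbs G K \<and> v \<in> nbs G K \<and> u \<noteq> v"
  by (auto simp: torso_def)

lemma pair_graph_torso:
  assumes "pair_graph G"
  shows "pair_graph (torso G K)"
  unfolding pair_graph_iff
proof (intro conjI)
  show "finite (pverts (torso G K))"
    using finite_pverts[OF assms] by simp
  show "parcs (torso G K) \<subseteq> pverts (torso G K) \<times> pverts (torso G K)"
    using parcs_in_pverts[OF assms] nbs_in_pverts[OF assms, of K]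
    by (auto simp: parcs_torso_iff nbs_iff)
  show "sym (parcs (torso G K))"
    using parcs_sym[OF assms] by (auto simp: sym_def parcs_torso_iff)
  show "irrefl (parcs (torso G K))"
    using parcs_irrefl[OF assms] by (auto simp: irrefl_def parcs_torso_iff)
qed

text \<open>The form in which linkedness gets applied: an upper bound T for the neighbourhood
  suffices, its exact value need not be known.\<close>

lemma linked_cover:
  assumes "linked k G X" "B \<subseteq> pverts G" "B \<inter> X \<noteq> {}" "nbs G B \<subseteq> T" "finite T" "card T < k"
  shows "X \<subseteq> B \<union> T"
proof -
  have "card (nbs G B) < k"
    using assms card_mono le_less_trans by metis
  then show ?thesis
    using assms unfolding linked_def by (meson Un_mono dual_order.trans leD order_refl)
qed

text \<open>Lifts a set of the torso back to G. K is absorbed exactly when A meets N(K); in that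
  case the clique edges already make every vertex of N(K) outside A a neighbour of A in the
  torso.\<close>

lemma nbs_subset_nbs_torso:
  assumes G: "pair_graph G" and A: "A \<inter> K = {}"
  shows "nbs G (if A \<inter> nbs G K = {} then A else A \<union> K) \<subseteq> nbs (torso G K) A"
    (is "nbs G ?B \<subseteq> _")
proof
  fix z assume "z \<in> nbs G ?B"
  then obtain y where z: "z \<notin> ?B" and y: "y \<in> ?B" "(y, z) \<in> parcs G"
    by (auto simp: nbs_iff)
  have zA: "z \<notin> A"
    using z by (auto split: if_splits)
  consider "y \<in> A" | "y \<in> K" "A \<inter> nbs G K \<noteq> {}"
    using y by (auto split: if_splits)
  then show "z \<in> nbs (torso G K) A"
  proof cases
    case 1
    then have "y \<notin> K"
      using A by auto
    moreover have "z \<notin> K"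
    proof
      assume "z \<in> K"
      then have "y \<in> nbs G K"
        using y \<open>y \<notin> K\<close> parcs_sym[OF G, of y z] by (auto simp: nbs_iff)
      then have "?B = A \<union> K"
        using 1 by auto
      then show False
        using z \<open>z \<in> K\<close> by simp
    qed
    ultimately show ?thesis
      using 1 y zA by (auto simp: nbs_iff parcs_torso_iff)
  next
    case 2
    then obtain s where "s \<in> A" "s \<in> nbs G K"
      by auto
    moreover have "z \<in> nbs G K"
      using 2 z y by (auto simp: nbs_iff)
    ultimately show ?thesis
      using zA by (auto simp: nbs_iff[of z _ A] parcs_torso_iff)
  qed
qed

text \<open>A small neighbourhood in the torso bounds that of the lifted set in G. The lifted set
  differs from A only within K, which misses X, so the cover of X in G is also one in the
  torso.\<close>

lemma linked_torso:
  assumes G: "pair_graph G" and l: "linked k G X" and K: "K \<subseteq> pverts G" "K \<inter> X = {}"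
  shows "linked k (torso G K) X"
  unfolding linked_def
proof (intro conjI allI impI)
  show "k < card X"
    using l by (simp add: linked_def)
  fix A assume A: "A \<subseteq> pverts (torso G K)" "A \<inter> X \<noteq> {}"
  define B where "B = (if A \<inter> nbs G K = {} then A else A \<union> K)"
  have sub: "nbs G B \<subseteq> nbs (torso G K) A"
    using A unfolding B_def by (intro nbs_subset_nbs_torso[OF G]) auto
  show "X \<subseteq> A \<union> nbs (torso G K) A \<or> k \<le> card (nbs (torso G K) A)"
  proof (rule disjCI)
    assume "\<not> k \<le> card (nbs (torso G K) A)"
    then have "X \<subseteq> B \<union> nbs (torso G K) A"
      using A K sub finite_nbs[OF pair_graph_torso[OF G]]
      by (intro linked_cover[OF l]) (auto simp: B_def)
    then show "X \<subseteq> A \<union> nbs (torso G K) A"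
      using K by (auto simp: B_def split: if_splits)
  qed
qed

text \<open>The contraction joins a to all other neighbours of y, and by assumption these already
  form a clique.\<close>

lemma contract_eq_torso:
  assumes G: "pair_graph G" and a: "(a, y) \<in> parcs G"
    and clq: "\<And>s t. (y, s) \<in> parcs G \<Longrightarrow> (y, t) \<in> parcs G \<Longrightarrow> s \<noteq> a \<Longrightarrow> t \<noteq> a \<Longrightarrow> s \<noteq> t \<Longrightarrow>
      (s, t) \<in> parcs G"
  shows "contract G a y = torso G {y}"
proof (rule pair_pre_digraph.equality)
  have "(u, v) \<in> parcs (contract G a y) \<longleftrightarrow> (u, v) \<in> parcs (torso G {y})" for u v
    using clq[of u v] a parcs_sym[OF G] parcs_irrefl[OF G]
    unfolding parcs_contract_iff parcs_torso_iff nbs_iff by auto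
  then show "parcs (contract G a y) = parcs (torso G {y})"
    by auto
qed auto

lemma contract_two_nbs:
  assumes G: "pair_graph G" and y: "a \<noteq> b" "nbs G {y} = {a, b}"
  shows "(a, y) \<in> parcs G" "(b, y) \<in> parcs G" "contract G a y = torso G {y}"
proof -
  have "a \<in> nbs G {y}" "b \<in> nbs G {y}"
    using y by auto
  then show ay: "(a, y) \<in> parcs G" and "(b, y) \<in> parcs G"
    using parcs_sym[OF G] by (auto simp: nbs_iff)
  have "z = a \<or> z = b" if "(y, z) \<in> parcs G" for z
  proof -
    have "z \<in> nbs G {y}"
      using that parcs_irrefl[OF G] by (auto simp: nbs_iff)
    then show ?thesis
      using y by auto
  qed
  then show "contract G a y = torso G {y}"
    by (intro contract_eq_torso[OF G ay]) blast
qed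

text \<open>
  The assumption on U says that H still connects a to b through K. The delicate case is that a set
  A of H contains a but b lies beyond N(A): then N(A) meets K, which pays for adding a or b to the
  separator.
\<close>

lemma linked_reroute:
  assumes G: "pair_graph G" and l: "linked k G X"
    and K: "K \<subseteq> pverts G" "K \<inter> X = {}" "nbs G K = {a, b}"
    and H: "pair_graph H" "pverts H = pverts G" "parcs H \<subseteq> parcs G"
      "\<And>u v. (u, v) \<in> parcs G \<Longrightarrow> u \<notin> K \<Longrightarrow> v \<notin> K \<Longrightarrow> (u, v) \<in> parcs H"
    and conn: "\<And>U. U \<subseteq> K \<Longrightarrow> \<exists>u \<in> insert a U. \<exists>w \<in> insert b (K - U). (u, w) \<in> parcs H"
  shows "linked k H X"
  unfolding linked_def
proof (intro conjI allI impI)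
  show kX: "k < card X"
    using l by (simp add: linked_def)
  fix A assume A: "A \<subseteq> pverts H" "A \<inter> X \<noteq> {}"
  define N where "N = nbs H A"
  have NA: "N \<inter> A = {}"
    by (auto simp: N_def nbs_iff)
  have fin: "finite N"
    using H finite_nbs by (auto simp: N_def)
  have abK: "a \<notin> K" "b \<notin> K" and abV: "a \<in> pverts G" "b \<in> pverts G"
    using K nbs_in_pverts[OF G, of K] by (auto simp: nbs_iff)
  have toK: "u = a \<or> u = b" if "(u, w) \<in> parcs G" "w \<in> K" "u \<notin> K" for u w
  proof -
    have "u \<in> nbs G K"
      using that parcs_sym[OF G] by (auto simp: nbs_iff)
    then show ?thesis
      using K by auto
  qed
  have fromK: "w = a \<or> w = b" if "(u, w) \<in> parcs G" "u \<in> K" "w \<notin> K" for u w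
    using toK[of w u] that parcs_sym[OF G] by auto
  have inN: "z \<in> N" if "(y, z) \<in> parcs G" "y \<in> A" "z \<notin> A" "y \<notin> K" "z \<notin> K" for y z
    using that H(4) by (auto simp: N_def nbs_iff)
  have out: "nbs G (A \<union> K) \<subseteq> (N - K) \<union> ({a, b} - A)"
    using inN fromK by (fastforce simp: nbs_iff)
  \<comment> \<open>Linkedness is applied to A with K added and to the far side with K added.
    Dropping N inside K frees one place in each separator, for b' and a' respectively. Together X
    lies in a', b' and N - K, at most k vertices, against k < |X|.\<close>
  have bad: False
    if ab': "{a', b'} = {a, b}" "a' \<in> A" "b' \<notin> A \<union> N" and NK: "N \<inter> K \<noteq> {}"
      and small: "card N < k" and nX: "\<not> X \<subseteq> A \<union> N" for a' b'
  proof -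
    have "card (N - K) < card N"
      using NK fin by (intro psubset_card_mono) auto
    then have c: "card (insert u (N - K)) < k" for u
      using small fin card_insert_le_m1[of "card N" "N - K" u] by (auto simp: card_insert_if)
    have b': "b' \<in> pverts G" "b' \<notin> K"
      using abV abK ab' by (auto simp: doubleton_eq_iff)
    have ab'': "{a, b} - A \<subseteq> {b'}"
      using ab' by (auto simp: doubleton_eq_iff)
    have "X \<subseteq> (A \<union> K) \<union> insert b' (N - K)"
    proof (rule linked_cover[OF l])
      show "nbs G (A \<union> K) \<subseteq> insert b' (N - K)"
        using out ab'' by blast
    qed (use A K H fin c[of b'] in auto)
    then have b'X: "b' \<in> X" "X \<subseteq> A \<union> insert b' (N - K)"
      using nX K by auto
    have "X \<subseteq> (pverts G - A - N) \<union> K \<union> insert a' (N - K)"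
    proof (intro linked_cover[OF l])
      show "nbs G (pverts G - A - N \<union> K) \<subseteq> insert a' (N - K)"
      proof
        fix z assume "z \<in> nbs G (pverts G - A - N \<union> K)"
        then obtain y where z: "z \<notin> K" "z \<in> A \<or> z \<in> N" "z \<noteq> b'"
          and y: "y \<in> K \<or> y \<notin> A \<and> y \<notin> N" "(y, z) \<in> parcs G"
          using parcs_in_pverts[OF G] ab' b' by (auto simp: nbs_iff)
        show "z \<in> insert a' (N - K)"
        proof (cases "y \<in> K")
          case True
          then have "z \<in> {a', b'}"
            using fromK[OF y(2)] z ab' by auto
          then show ?thesis
            using z by auto
        next
          case False
          then have "z \<notin> A"
            using y z inN[of z y] parcs_sym[OF G] by auto
          then show ?thesis
            using z by auto
        qed
      qed
    next
      show "(pverts G - A - N \<union> K) \<inter> X \<noteq> {}"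
        using b' b'X ab' by auto
    qed (use K fin c[of a'] in auto)
    then have "X \<subseteq> insert a' (insert b' (N - K))"
      using b'X K NA by blast
    then have "card X \<le> card (insert a' (insert b' (N - K)))"
      using fin by (intro card_mono) auto
    also have "\<dots> \<le> Suc (card (insert b' (N - K)))"
      by (simp add: card_insert_le_m1 card_insert_if fin)
    finally show False
      using c[of b'] kX by linarith
  qed
  show "X \<subseteq> A \<union> nbs H A \<or> k \<le> card (nbs H A)"
    unfolding N_def[symmetric]
  proof (rule ccontr)
    assume "\<not> (X \<subseteq> A \<union> N \<or> k \<le> card N)"
    then have nX: "\<not> X \<subseteq> A \<union> N" and small: "card N < k"
      by auto
    have 1: False if "{a, b} \<subseteq> A \<union> N"
    proof -
      have "X \<subseteq> (A \<union> K) \<union> N"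
        using A K H out fin small that by (intro linked_cover[OF l]) auto
      then show False
        using nX K by auto
    qed
    have 2: False if "a \<notin> A" "b \<notin> A"
    proof -
      have "nbs G (A - K) \<subseteq> N"
      proof
        fix z assume "z \<in> nbs G (A - K)"
        then obtain y where y: "y \<in> A" "y \<notin> K" "(y, z) \<in> parcs G" "z \<notin> A - K"
          by (auto simp: nbs_iff)
        have "z \<notin> K"
          using toK[OF y(3)] y that by auto
        then show "z \<in> N"
          using y inN[of y z] by auto
      qed
      then have "X \<subseteq> (A - K) \<union> N"
        using A K H fin small by (intro linked_cover[OF l]) auto
      then show False
        using nX by auto
    qed
    \<comment> \<open>The cut condition is used for the part of K inside A and for its complement,
      because either a or b may be the end in A. The arc crossing out of A must end in N and in
      K.\<close>
    obtain u w where uw: "u \<in> insert a (A \<inter> K)" "w \<in> insert b (K - A \<inter> K)" "(u, w) \<in> parcs H"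
      using conn[of "A \<inter> K"] by auto
    obtain u' w' where uw': "u' \<in> insert a (K - A \<inter> K)" "w' \<in> insert b (A \<inter> K)" "(u', w') \<in> parcs H"
      using conn[of "K - A \<inter> K"] by auto
    consider "a \<in> A" "b \<notin> A \<union> N" | "b \<in> A" "a \<notin> A \<union> N"
      using 1 2 by auto
    then show False
    proof cases
      case 1
      then have "w \<in> N \<inter> K"
        using uw by (auto simp: N_def nbs_iff)
      then show False
        using bad[of a b] 1 small nX by blast
    next
      case 2
      then have "u' \<in> N \<inter> K"
        using uw' parcs_sym[OF H(1)] by (auto simp: N_def nbs_iff)
      then show False
        using bad[of b a] 2 small nX by blast
    qed
  qed
qed

text \<open>If A violates the condition for the whole vertex set, so does the rest beyond N(A),
  whose neighbourhood lies in N(A). Linkedness of X prevents X from meeting both sides.\<close>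

lemma not_linked_pverts_obtains:
  assumes G: "pair_graph G" and X: "X \<subseteq> pverts G" and l: "linked k G X"
    and "\<not> linked k G (pverts G)"
  obtains K where "K \<noteq> {}" "K \<subseteq> pverts G" "K \<inter> X = {}" "card (nbs G K) < k"
proof -
  have "card X \<le> card (pverts G)"
    using X finite_pverts[OF G] by (rule card_mono[rotated])
  then have "k < card (pverts G)"
    using l by (simp add: linked_def)
  then obtain A where A: "A \<subseteq> pverts G" "A \<inter> pverts G \<noteq> {}" "\<not> pverts G \<subseteq> A \<union> nbs G A"
    "card (nbs G A) < k"
    using assms(4) unfolding linked_def by (meson not_le)
  let ?B = "pverts G - A - nbs G A"
  have "nbs G ?B \<subseteq> nbs G A"
  proof
    fix z assume "z \<in> nbs G ?B"
    then obtain y where y: "y \<in> ?B" "(z, y) \<in> parcs G" "z \<notin> ?B" "z \<in> pverts G"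
      using parcs_sym[OF G] parcs_in_pverts[OF G] unfolding nbs_iff by blast
    then show "z \<in> nbs G A"
      by (auto simp: nbs_iff)
  qed
  then have B: "card (nbs G ?B) < k"
    using A finite_nbs[OF G] by (meson card_mono le_less_trans)
  show ?thesis
  proof (cases "A \<inter> X = {}")
    case True
    then show ?thesis
      using A that by blast
  next
    case False
    then have "X \<subseteq> A \<union> nbs G A"
      using A l unfolding linked_def by (meson not_le)
    then have "?B \<inter> X = {}"
      by auto
    then show ?thesis
      using A B that[of ?B] by blast
  qed
qed

section \<open>Suppressible vertices of degree two\<close>

lemma torso_subgraph:
  assumes "pair_graph G" "card (nbs G K) \<le> 1"
  shows "parcs (torso G K) \<subseteq> parcs G"
  using assms finite_nbs[OF assms(1)] card_le_Suc0_iff_eq[of "nbs G K"]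
  by (auto simp: parcs_torso_iff)

text \<open>Take a smallest nonempty K that avoids X and has at most two neighbours. Unless these
  are two nonadjacent vertices, the torso is a proper linked subgraph. By the choice of K, its
  proper nonempty subsets have at least three neighbours, which supplies the connection that
  \<open>linked_reroute\<close> asks for.\<close>

lemma suppressible_vertex:
  assumes G: "pair_graph G" and X: "X \<subseteq> pverts G" and l: "linked k G X"
    and min: "\<And>H. pair_graph H \<Longrightarrow> pverts H \<subseteq> pverts G \<Longrightarrow> parcs H \<subseteq> parcs G \<Longrightarrow> X \<subseteq> pverts H
      \<Longrightarrow> linked k H X \<Longrightarrow> H = G"
    and ex: "K0 \<noteq> {}" "K0 \<subseteq> pverts G" "K0 \<inter> X = {}" "card (nbs G K0) \<le> 2"
  obtains y a b where "y \<in> pverts G" "y \<notin> X" "a \<noteq> b" "nbs G {y} = {a, b}" "(a, b) \<notin> parcs G"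
proof -
  define P where "P K \<longleftrightarrow> K \<noteq> {} \<and> K \<subseteq> pverts G \<and> K \<inter> X = {} \<and> card (nbs G K) \<le> 2" for K
  have "P K0"
    using ex by (simp add: P_def)
  then obtain K where PK: "P K" and least: "\<And>K'. P K' \<Longrightarrow> card K \<le> card K'"
    using ex_has_least_nat[of P K0 card] by blast
  note K = PK[unfolded P_def]
  have finK: "finite K"
    using K finite_pverts[OF G] finite_subset by blast
  have notsub: "\<not> parcs (torso G K) \<subseteq> parcs G"
  proof
    assume "parcs (torso G K) \<subseteq> parcs G"
    then have "torso G K = G"
      using K X linked_torso[OF G l] by (intro min pair_graph_torso G) auto
    then have "pverts G - K = pverts G"
      by (metis pverts_torso)
    then show False
      using K by auto
  qed
  then have "card (nbs G K) \<noteq> 0 \<and> card (nbs G K) \<noteq> 1"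
    using torso_subgraph[OF G, of K] by (metis le_numeral_extra(4) zero_le_one)
  then have "card (nbs G K) = 2"
    using K by linarith
  then obtain a b where ab: "nbs G K = {a, b}" "a \<noteq> b"
    by (auto simp: card_2_iff)
  have nab: "(a, b) \<notin> parcs G"
    using notsub ab parcs_sym[OF G] by (auto simp: parcs_torso_iff)
  have abK: "a \<notin> K" "b \<notin> K"
    using ab by (auto simp: nbs_iff)
  have "a \<in> nbs G K" "b \<in> nbs G K"
    using ab by auto
  then obtain y y' where y: "y \<in> K" "(y, a) \<in> parcs G" and y': "y' \<in> K" "(y', b) \<in> parcs G"
    by (auto simp: nbs_iff)
  \<comment> \<open>y alone suffices as the neighbour of a in K, so minimality of G forces H = G and K = {y}\<close>
  define H where "H = \<lparr>pverts = pverts G,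
    parcs = parcs G - {(a, z) |z. z \<in> K \<and> z \<noteq> y} - {(z, a) |z. z \<in> K \<and> z \<noteq> y}\<rparr>"
  have H_iff: "(u, v) \<in> parcs H \<longleftrightarrow> (u, v) \<in> parcs G \<and> \<not> (u = a \<and> v \<in> K \<and> v \<noteq> y)
    \<and> \<not> (v = a \<and> u \<in> K \<and> u \<noteq> y)" for u v
    by (auto simp: H_def)
  have pH: "pair_graph H"
    using G unfolding pair_graph_iff by (auto simp: H_def sym_def irrefl_def)
  have subs: "K' = {} \<or> K' = K \<or> 2 < card (nbs G K')" if "K' \<subseteq> K" for K'
  proof (rule ccontr)
    assume A: "\<not> ?thesis"
    then have "P K'"
      using that K by (auto simp: P_def)
    moreover have "card K' < card K"
      using A that finK by (intro psubset_card_mono) auto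
    ultimately show False
      using least by force
  qed
  have "linked k H X"
  proof (rule linked_reroute[OF G l _ _ ab(1) pH])
    fix U assume U: "U \<subseteq> K"
    show "\<exists>u \<in> insert a U. \<exists>w \<in> insert b (K - U). (u, w) \<in> parcs H"
    proof (cases "y \<in> U")
      case False
      then show ?thesis
        using y parcs_sym[OF G] by (auto simp: H_iff)
    next
      case True
      show ?thesis
      proof (cases "U = K")
        case True
        then show ?thesis
          using y' ab abK by (auto simp: H_iff)
      next
        case False
        \<comment> \<open>One of the three neighbours of U differs from a, and the arc leading to it
          survives in \<open>H\<close>.\<close>
        then have "2 < card (nbs G U)"
          using subs[OF U] True by auto
        then have "\<not> nbs G U \<subseteq> {a}"
          using card_mono[of "{a}" "nbs G U"] by auto
        then obtain w where "w \<in> nbs G U" "w \<noteq> a"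
          by blast
        then obtain u where w: "u \<in> U" "(u, w) \<in> parcs G" "w \<notin> U" "w \<noteq> a"
          by (auto simp: nbs_iff)
        have "w \<in> insert b (K - U)"
        proof (cases "w \<in> K")
          case False
          then have "w \<in> nbs G K"
            using w U by (auto simp: nbs_iff)
          then show ?thesis
            using ab w by auto
        qed (use w in auto)
        then show ?thesis
          using w U abK by (auto simp: H_iff)
      qed
    qed
  qed (use K abK in \<open>auto simp: H_def\<close>)
  then have "H = G"
    using X pH by (intro min) (auto simp: H_def)
  then have "(u, a) \<notin> parcs G" if "u \<in> K" "u \<noteq> y" for u
    using H_iff[of u a] that by simp
  \<comment> \<open>With y the only neighbour of a in K, the rest of K has at most two neighbours
    and must be empty by the choice of K.\<close>
  then have "nbs G (K - {y}) \<subseteq> {y, b}"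
    using ab abK by (fastforce simp: nbs_iff)
  then have "card (nbs G (K - {y})) \<le> card {y, b}"
    by (intro card_mono) auto
  also have "\<dots> \<le> 2"
    by (simp add: card_insert_if)
  finally have "K = {y}"
    using subs[of "K - {y}"] y by auto
  then show ?thesis
    using K ab nab that by auto
qed

section \<open>Topological rooted minors\<close>

text \<open>The subdivision \<open>D\<close> is carried through the induction as an actual subgraph
  of G. Passing to a linked proper subgraph leaves \<open>D\<close> unchanged; undoing the
  suppression of a vertex costs at most one further subdivision step.\<close>

lemma topological_rooted_minor_exists:
  assumes "pair_graph G" "X \<subseteq> pverts G" "linked k G X" "k \<le> 3"
  shows "\<exists>M D. subdivision_pair M D \<and> rooted_minor X G M \<and> linked k M (pverts M) \<and>
    pair_graph D \<and> pverts D \<subseteq> pverts G \<and> parcs D \<subseteq> parcs G"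
  using assms
proof (induct G rule: pair_graph_size_induct)
  case (less G)
  note G = less.prems(1) and X = less.prems(2) and l = less.prems(3)
  show ?case
  proof (cases "linked k G (pverts G)")
    case True
    have "subdivision_pair G G"
      using G by (intro subdivision_pair_base) (simp add: pair_graph_def pair_bidirected_digraph_def
        pair_digraph_def pair_pseudo_graph_def)
    then show ?thesis
      using True G rooted_minor_refl[OF G X] by blast
  next
    case nk: False
    show ?thesis
    proof (cases "\<exists>H. pair_graph H \<and> pverts H \<subseteq> pverts G \<and> parcs H \<subseteq> parcs G \<and> X \<subseteq> pverts H
        \<and> linked k H X \<and> H \<noteq> G")
      case True
      then obtain H where H: "pair_graph H" "pverts H \<subseteq> pverts G" "parcs H \<subseteq> parcs G"
        "X \<subseteq> pverts H" "linked k H X" "H \<noteq> G"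
        by auto
      from less.hyps[OF smaller_subgraph[OF G H(2,3,6)] H(1,4,5) \<open>k \<le> 3\<close>] show ?thesis
        using rooted_minor_of_subgraph[OF G H(1-4)] rooted_minor_trans H by blast
    next
      case False
      obtain K where K: "K \<noteq> {}" "K \<subseteq> pverts G" "K \<inter> X = {}" "card (nbs G K) < k"
        using not_linked_pverts_obtains[OF G X l nk] by blast
      then have "card (nbs G K) \<le> 2"
        using \<open>k \<le> 3\<close> by linarith
      then obtain y a b where y: "y \<in> pverts G" "y \<notin> X" "a \<noteq> b" "nbs G {y} = {a, b}"
        "(a, b) \<notin> parcs G"
        using suppressible_vertex[OF G X l _ K(1-3)] False by metis
      note ay = contract_two_nbs[OF G y(3,4)]
      let ?H = "contract G a y"
      have H: "pair_graph ?H" "X \<subseteq> pverts ?H" "linked k ?H X"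
        using pair_graph_contract[OF G ay(1)] X y linked_torso[OF G l, of "{y}"] ay(3) by auto
      have arcsH: "(u, v) \<in> parcs ?H \<longleftrightarrow> (u, v) \<in> parcs G \<and> u \<noteq> y \<and> v \<noteq> y
        \<or> (u, v) = (a, b) \<or> (u, v) = (b, a)" for u v
        unfolding ay(3) parcs_torso_iff y(4) using y(3) by auto
      have "card (pverts ?H) < card (pverts G)"
        using y finite_pverts[OF G] by (intro psubset_card_mono) auto
      from less.hyps[OF disjI1[OF this] H \<open>k \<le> 3\<close>] obtain M D where
        MD: "subdivision_pair M D" "rooted_minor X ?H M" "linked k M (pverts M)" "pair_graph D"
          "pverts D \<subseteq> pverts ?H" "parcs D \<subseteq> parcs ?H"
        by blast
      have rm: "rooted_minor X G M"
        using MD rooted_minor_contract[OF G X ay(1) y(2)] rooted_minor_trans by blast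
      show ?thesis
      \<comment> \<open>The edge ab is the only one that the contraction has beyond G. If
        \<open>D\<close> uses it, it is replaced by the path through y.\<close>
      proof (cases "(a, b) \<in> parcs D")
        case True
        have yD: "y \<notin> pverts D"
          using MD by auto
        have "subdivision_pair M (subdivide D (a, b) y)"
          using MD True yD by (intro subdivision_pair_divide)
        moreover have "pair_graph (subdivide D (a, b) y)"
          using MD True yD by (intro pair_graph.pair_graph_subdivide)
        moreover have "pverts (subdivide D (a, b) y) \<subseteq> pverts G"
          using MD y by auto
        moreover have "parcs (subdivide D (a, b) y) \<subseteq> parcs G"
          using MD(6) arcsH ay(1,2) parcs_sym[OF G] by auto
        ultimately show ?thesis
          using MD rm by blast
      next
        case False
        then have "parcs D \<subseteq> parcs G"
          using MD(6) arcsH parcs_sym[OF MD(4)] by fastforce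
        then show ?thesis
          using MD rm by auto
      qed
    qed
  qed
qed

text \<open>Since \<open>D\<close> already lies in G, the identity serves as the
  isomorphism.\<close>

lemma topological_rooted_minorI:
  assumes "pair_graph G" "subdivision_pair M D" "rooted_minor X G M"
    "pair_graph D" "pverts D \<subseteq> pverts G" "parcs D \<subseteq> parcs G"
  shows "topological_rooted_minor X G M"
proof -
  let ?f = "\<lparr>iso_verts = id, iso_arcs = id, iso_head = snd, iso_tail = fst\<rparr>
    :: ('a, 'a \<times> 'a, 'a, 'a \<times> 'a) digraph_isomorphism"
  have "subgraph (with_proj D) (with_proj G)"
    using assms by (simp add: subgraph_with_proj_iff)
  moreover from this have "subgraph (app_iso ?f (with_proj D)) (with_proj G)"
    by (simp add: app_iso_def with_proj_def)
  moreover have "pre_digraph.digraph_isomorphism (with_proj D) ?f"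
    using calculation(1) by (auto simp: pre_digraph.digraph_isomorphism_def)
  ultimately show ?thesis
    unfolding topological_rooted_minor_def using assms
    by (intro conjI exI[of _ D] exI[of _ ?f]) auto
qed

section \<open>Torsos as rooted minors\<close>

text \<open>Contract y into a, then z into b. The first step creates ac and either az or ab, the
  second creates bc and, if still missing, ab.\<close>

lemma rooted_minor_torso_two:
  assumes G: "pair_graph G" and X: "X \<subseteq> pverts G" and yz: "y \<notin> X" "z \<notin> X" "y \<noteq> z"
    and T: "nbs G {y, z} = {a, b, c}" "a \<noteq> b" "a \<noteq> c" "b \<noteq> c"
    and arcs: "(y, a) \<in> parcs G" "(y, c) \<in> parcs G" "(z, b) \<in> parcs G" "(z, c) \<in> parcs G"
      "(y, z) \<in> parcs G \<or> (y, b) \<in> parcs G"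
  shows "rooted_minor X G (torso G {y, z})"
proof -
  note sym = parcs_sym[OF G] and irr = parcs_irrefl[OF G]
  have "a \<in> nbs G {y, z}" "b \<in> nbs G {y, z}" "c \<in> nbs G {y, z}"
    using T by auto
  then have dist: "a \<noteq> y" "a \<noteq> z" "b \<noteq> y" "b \<noteq> z" "c \<noteq> y" "c \<noteq> z"
    by (auto simp: nbs_iff)
  have Ny: "v = z \<or> v = a \<or> v = b \<or> v = c" if "(y, v) \<in> parcs G" for v
  proof (cases "v = z")
    case False
    then have "v \<in> nbs G {y, z}"
      using that irr by (auto simp: nbs_iff)
    then show ?thesis
      using T by auto
  qed simp
  have Nz: "v = y \<or> v = a \<or> v = b \<or> v = c" if "(z, v) \<in> parcs G" for v
  proof (cases "v = y")
    case False
    then have "v \<in> nbs G {y, z}"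
      using that irr by (auto simp: nbs_iff)
    then show ?thesis
      using T by auto
  qed simp
  let ?G1 = "contract G a y" and ?G2 = "contract (contract G a y) b z"
  have G1: "(u, v) \<in> parcs ?G1 \<longleftrightarrow> (u, v) \<in> parcs G \<and> u \<noteq> y \<and> v \<noteq> y
     \<or> u = a \<and> v \<noteq> a \<and> (y, v) \<in> parcs G \<or> v = a \<and> u \<noteq> a \<and> (y, u) \<in> parcs G" for u v
    by (rule parcs_contract_iff)
  have ay: "(a, y) \<in> parcs G"
    using arcs sym by blast
  have bz: "(b, z) \<in> parcs ?G1"
    using arcs sym[of z b] dist yz by (simp add: G1)
  have pg: "pair_graph ?G2"
    using G ay bz by (intro pair_graph_contract)
  note sym2 = parcs_sym[OF pg]
  have "?G2 = torso G {y, z}"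
  proof (rule pair_pre_digraph.equality)
    show "parcs ?G2 = parcs (torso G {y, z})"
    proof (intro equalityI subrelI)
      fix u v assume "(u, v) \<in> parcs ?G2"
      then show "(u, v) \<in> parcs (torso G {y, z})"
        unfolding parcs_contract_iff[of _ _ _ b z] G1 parcs_torso_iff T(1)
        using Ny Nz dist T yz by blast
    next
      have "(b, a) \<in> parcs ?G2"
        unfolding parcs_contract_iff[of _ _ _ b z] G1 using arcs dist T yz by auto
      moreover have "(a, c) \<in> parcs ?G2"
        unfolding parcs_contract_iff[of _ _ _ b z] G1 using arcs dist T yz by auto
      moreover have "(b, c) \<in> parcs ?G2"
        unfolding parcs_contract_iff[of _ _ _ b z] G1 using arcs dist T yz by auto
      ultimately have tri: "(u, v) \<in> parcs ?G2" if "u \<in> {a, b, c}" "v \<in> {a, b, c}" "u \<noteq> v" for u v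
        using that sym2 by blast
      fix u v assume "(u, v) \<in> parcs (torso G {y, z})"
      then consider "(u, v) \<in> parcs G" "u \<noteq> y" "u \<noteq> z" "v \<noteq> y" "v \<noteq> z"
        | "u \<in> {a, b, c}" "v \<in> {a, b, c}" "u \<noteq> v"
        unfolding parcs_torso_iff T(1) by blast
      then show "(u, v) \<in> parcs ?G2"
      proof cases
        case 1
        then show ?thesis
          unfolding parcs_contract_iff[of _ _ _ b z] G1 by blast
      qed (rule tri)
    qed
  qed auto
  moreover have "rooted_minor X G ?G2"
    using bz yz ay G X by (intro rooted_minor.contract[of _ _ ?G1] rooted_minor_contract)
  ultimately show ?thesis
    by simp
qed

text \<open>Allows a torso to be formed in two stages. A vertex of K - K' in N(K') becomes adjacent
  to all of N(K'), so the boundary of K contributed by K' is not lost after the first stage.\<close>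

lemma torso_torso:
  assumes G: "pair_graph G" and K: "K' \<subseteq> K" and meet: "(K - K') \<inter> nbs G K' \<noteq> {}"
  shows "nbs (torso G K') (K - K') = nbs G K" "torso (torso G K') (K - K') = torso G K"
proof -
  obtain y where y: "y \<in> K" "y \<notin> K'" "y \<in> nbs G K'"
    using meet by auto
  show n: "nbs (torso G K') (K - K') = nbs G K"
  proof (intro equalityI subsetI)
    fix t assume "t \<in> nbs (torso G K') (K - K')"
    then show "t \<in> nbs G K"
      using K by (auto simp: nbs_iff parcs_torso_iff)
  next
    fix t assume "t \<in> nbs G K"
    then obtain x where t: "t \<notin> K" "x \<in> K" "(x, t) \<in> parcs G"
      by (auto simp: nbs_iff)
    show "t \<in> nbs (torso G K') (K - K')"
    proof (cases "x \<in> K'")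
      case True
      then have "t \<in> nbs G K'"
        using t K by (auto simp: nbs_iff)
      then have "(y, t) \<in> parcs (torso G K')"
        using y t by (auto simp: parcs_torso_iff)
      then show ?thesis
        using y t by (auto simp: nbs_iff[of t "torso G K'"])
    next
      case False
      then have "(x, t) \<in> parcs (torso G K')"
        using t K by (auto simp: parcs_torso_iff)
      then show ?thesis
        using False t by (auto simp: nbs_iff[of t "torso G K'"])
    qed
  qed
  have sub: "t \<in> nbs G K" if "t \<in> nbs G K'" "t \<notin> K" for t
    using that K by (auto simp: nbs_iff)
  have out: "t \<notin> K" if "t \<in> nbs G K" for t
    using that by (auto simp: nbs_iff)
  show "torso (torso G K') (K - K') = torso G K"
  proof (rule pair_pre_digraph.equality)
    have "(u, v) \<in> parcs (torso (torso G K') (K - K')) \<longleftrightarrow> (u, v) \<in> parcs (torso G K)" for u v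
      unfolding parcs_torso_iff[of _ _ "torso G K'"] parcs_torso_iff n
      using K sub out nbs_iff[of u G K'] nbs_iff[of v G K'] by blast
    then show "parcs (torso (torso G K') (K - K')) = parcs (torso G K)"
      by auto
  qed (use K in auto)
qed

text \<open>A set containing y stands for itself with z adjoined; for any other set z is merely
  renamed to y. A neighbour is lost in the second case only if both y and z were neighbours.\<close>

lemma nbs_contract:
  assumes "pair_graph G" "(y, z) \<in> parcs G" "z \<notin> A"
  shows "nbs (contract G y z) A = (if y \<in> A then nbs G (insert z A)
    else nbs G A - {z} \<union> (if z \<in> nbs G A then {y} else {}))"
proof -
  have yz: "(z, y) \<in> parcs G" "y \<noteq> z"
    using assms parcs_sym[OF assms(1)] parcs_irrefl[OF assms(1)] by auto
  have rev: "(v, z) \<in> parcs G" if "(z, v) \<in> parcs G" for v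
    using that parcs_sym[OF assms(1)] by blast
  have rev': "(z, v) \<in> parcs G" if "(v, z) \<in> parcs G" for v
    using that parcs_sym[OF assms(1)] by blast
  show ?thesis
  proof (cases "y \<in> A")
    case True
    have "v \<in> nbs (contract G y z) A \<longleftrightarrow> v \<in> nbs G (insert z A)" for v
      unfolding nbs_iff parcs_contract_iff
      using True assms yz parcs_irrefl[OF assms(1)] by blast
    then show ?thesis
      using True by auto
  next
    case False
    have "v \<in> nbs (contract G y z) A \<longleftrightarrow> v \<in> nbs G A \<and> v \<noteq> z \<or> v = y \<and> z \<in> nbs G A" for v
      unfolding nbs_iff parcs_contract_iff
      using False assms yz parcs_irrefl[OF assms(1)] rev rev' by blast
    then show ?thesis
      using False by auto
  qed
qed

text \<open>
  Contract an arc yz inside K. This can only fail if some K' in K has exactly three neighbours, two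
  of them being y and z; then K' itself falls under the induction hypothesis, because N(K') contains
  an arc.
\<close>

lemma rooted_minor_torso_three:
  assumes "pair_graph G" "X \<subseteq> pverts G" "K \<subseteq> pverts G" "K \<inter> X = {}" "K \<noteq> {}" "card (nbs G K) = 3"
    and "\<And>K'. K' \<subseteq> K \<Longrightarrow> K' \<noteq> {} \<Longrightarrow> 3 \<le> card (nbs G K')"
    and "2 \<le> card K \<or> (\<exists>s \<in> nbs G K. \<exists>t \<in> nbs G K. (s, t) \<in> parcs G)"
  shows "rooted_minor X G (torso G K)"
  using assms
proof (induct "card K" arbitrary: G K rule: less_induct)
  case less
  note G = less.prems(1) and X = less.prems(2) and K = less.prems(3-5) and T = less.prems(6)
    and big = less.prems(7) and IH = less.hyps
  note sym = parcs_sym[OF G] and irr = parcs_irrefl[OF G]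
  have finK: "finite K"
    using K finite_pverts[OF G] finite_subset by blast
  consider (one) "card K = 1" | (two) "card K = 2"
    | (edge) y z where "3 \<le> card K" "y \<in> K" "z \<in> K" "(y, z) \<in> parcs G"
    | (indep) "3 \<le> card K" "\<And>y z. y \<in> K \<Longrightarrow> z \<in> K \<Longrightarrow> (y, z) \<notin> parcs G"
  proof -
    have "card K \<noteq> 0"
      using finK K by simp
    then have "card K = 1 \<or> card K = 2 \<or> 3 \<le> card K"
      by linarith
    then show ?thesis
      using that by blast
  qed
  then show ?case
  proof cases
    case one
    then obtain y where y: "K = {y}"
      by (auto simp: card_1_singleton_iff)
    obtain s t where st: "s \<in> nbs G K" "t \<in> nbs G K" "(s, t) \<in> parcs G"
      using less.prems(8) one by auto
    have "s \<noteq> t"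
      using st irr by auto
    \<comment> \<open>The third neighbour a absorbs y: contraction supplies its arcs to s and t, and
      st is present already.\<close>
    then have "card (nbs G K - {s, t}) = 1"
      using st T by (subst card_Diff_subset) auto
    then obtain a where "nbs G K - {s, t} = {a}"
      by (auto simp: card_1_singleton_iff)
    then have a: "nbs G K = {a, s, t}" "a \<noteq> s" "a \<noteq> t"
      using st by auto
    have Ny: "v \<in> {a, s, t}" if "(y, v) \<in> parcs G" for v
      using that a irr y by (auto simp: nbs_iff)
    have "a \<in> nbs G K"
      using a by auto
    then have ay: "(a, y) \<in> parcs G"
      using y sym by (auto simp: nbs_iff)
    then have "contract G a y = torso G {y}"
      using Ny st sym by (intro contract_eq_torso[OF G]) blast+
    then show ?thesis
      using rooted_minor_contract[OF G X ay] K y by auto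
  next
    case two
    then obtain y z where yz: "K = {y, z}" "y \<noteq> z"
      by (auto simp: card_2_iff)
    let ?T = "nbs G K"
    define Ay where "Ay = nbs G {y} \<inter> ?T"
    define Az where "Az = nbs G {z} \<inter> ?T"
    have fin: "finite (nbs G A)" for A
      using finite_nbs[OF G] .
    have un: "Ay \<union> Az = ?T"
      using yz irr by (auto simp: Ay_def Az_def nbs_iff)
    have Ty: "nbs G {y} = Ay \<union> (if (y, z) \<in> parcs G then {z} else {})"
      using yz irr by (auto simp: Ay_def nbs_iff)
    have Tz: "nbs G {z} = Az \<union> (if (y, z) \<in> parcs G then {y} else {})"
      using yz irr sym by (auto simp: Az_def nbs_iff)
    have b3: "3 \<le> card (nbs G {y})" "3 \<le> card (nbs G {z})"
      using big[of "{y}"] big[of "{z}"] yz by auto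
    have fA: "finite Ay" "finite Az"
      using fin by (auto simp: Ay_def Az_def)
    have c2: "2 \<le> card Ay" "2 \<le> card Az"
      using b3 fA card_insert_if[OF fA(1), of z] card_insert_if[OF fA(2), of y]
      unfolding Ty Tz by (auto split: if_splits)
    have full: "Ay = ?T" if "(y, z) \<notin> parcs G"
      using that b3(1) T fin unfolding Ty by (intro card_seteq) (auto simp: Ay_def)
    \<comment> \<open>Here b is to absorb z, so y must see the other two boundary vertices: if y
      misses one, that one is b. A second boundary neighbour c of z is then common to y and z, and
      the remaining vertex a absorbs y.\<close>
    obtain b where b: "b \<in> Az" "?T - {b} \<subseteq> Ay" "(y, z) \<in> parcs G \<or> b \<in> Ay"
    proof (cases "Ay = ?T")
      case True
      obtain b where "b \<in> Az"
        using c2 by fastforce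
      then show ?thesis
        using True that by (auto simp: Az_def)
    next
      case False
      then obtain b where b: "b \<in> ?T" "b \<notin> Ay"
        by (auto simp: Ay_def)
      have "insert b Ay = ?T"
        using b c2 T fin fA by (intro card_seteq) (auto simp: Ay_def)
      then show ?thesis
        using b un full that[of b] by auto
    qed
    have "1 \<le> card (Az - {b})"
      using c2 b fA by simp
    then obtain c where c: "c \<in> Az" "c \<noteq> b"
      by (metis DiffE card.empty equals0I insertI1 not_one_le_zero)
    have bcT: "b \<in> ?T" "c \<in> ?T"
      using b c by (auto simp: Az_def)
    then have "card (?T - {b, c}) = 1"
      using c T by (subst card_Diff_subset) auto
    then obtain a where "?T - {b, c} = {a}"
      by (auto simp: card_1_singleton_iff)
    then have a: "?T = {a, b, c}" "a \<noteq> b" "a \<noteq> c"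
      using bcT by auto
    have "a \<in> Ay" "c \<in> Ay"
      using a b c by auto
    then have "(y, a) \<in> parcs G" "(y, c) \<in> parcs G"
      by (auto simp: Ay_def nbs_iff)
    moreover have "(z, b) \<in> parcs G" "(z, c) \<in> parcs G"
      using b c by (auto simp: Az_def nbs_iff)
    moreover have "(y, z) \<in> parcs G \<or> (y, b) \<in> parcs G"
      using b by (auto simp: Ay_def nbs_iff)
    moreover have "y \<notin> X" "z \<notin> X"
      using K yz by auto
    moreover have "nbs G {y, z} = {a, b, c}"
      using a yz by simp
    ultimately show ?thesis
      unfolding yz(1) using rooted_minor_torso_two[OF G X] a c yz by metis
  next
    case (edge y z)
    have yz: "y \<noteq> z"
      using edge irr by auto
    show ?thesis
    proof (cases "\<exists>K' \<subseteq> K - {y, z}. K' \<noteq> {} \<and> y \<in> nbs G K' \<and> z \<in> nbs G K' \<and> card (nbs G K') = 3")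
      case True
      then obtain K' where K': "K' \<subseteq> K - {y, z}" "K' \<noteq> {}" "y \<in> nbs G K'" "z \<in> nbs G K'"
        "card (nbs G K') = 3"
        by auto
      have "card K' < card K"
        using K' finK edge by (intro psubset_card_mono) auto
      have 1: "rooted_minor X G (torso G K')"
      proof (rule IH[OF \<open>card K' < card K\<close> G X])
        show "K' \<subseteq> pverts G" "K' \<inter> X = {}" "K' \<noteq> {}" "card (nbs G K') = 3"
          using K K' by auto
        show "3 \<le> card (nbs G L)" if "L \<subseteq> K'" "L \<noteq> {}" for L
          using that K' big[of L] by auto
        show "2 \<le> card K' \<or> (\<exists>s \<in> nbs G K'. \<exists>t \<in> nbs G K'. (s, t) \<in> parcs G)"
          using K' edge by blast
      qed
      let ?G1 = "torso G K'" and ?K2 = "K - K'"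
      have tt: "nbs ?G1 ?K2 = nbs G K" "torso ?G1 ?K2 = torso G K"
        using torso_torso[OF G, of K' K] K' edge by auto
      have "rooted_minor X ?G1 (torso ?G1 ?K2)"
      proof (rule IH)
        show "card ?K2 < card K"
          using K' finK by (intro psubset_card_mono) auto
        show "pair_graph ?G1"
          using G by (rule pair_graph_torso)
        show "X \<subseteq> pverts ?G1" "?K2 \<subseteq> pverts ?G1" "?K2 \<inter> X = {}" "?K2 \<noteq> {}"
          using X K K' edge by auto
        show "card (nbs ?G1 ?K2) = 3"
          using tt T by simp
        have "card {y, z} \<le> card ?K2"
          using K' edge finK by (intro card_mono) auto
        then show "2 \<le> card ?K2 \<or> (\<exists>s \<in> nbs ?G1 ?K2. \<exists>t \<in> nbs ?G1 ?K2. (s, t) \<in> parcs ?G1)"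
          using yz by simp
        fix L assume L: "L \<subseteq> ?K2" "L \<noteq> {}"
        \<comment> \<open>\<open>?B\<close> is L lifted from the torso to G, so the lower bound on
          neighbourhoods in G carries over.\<close>
        let ?B = "if L \<inter> nbs G K' = {} then L else L \<union> K'"
        have "3 \<le> card (nbs G ?B)"
          using L K' by (intro big) auto
        also have "\<dots> \<le> card (nbs ?G1 L)"
          using L G by (intro card_mono finite_nbs pair_graph_torso nbs_subset_nbs_torso) auto
        finally show "3 \<le> card (nbs ?G1 L)" .
      qed
      then show ?thesis
        using 1 tt(2) rooted_minor_trans by metis
    next
      case False
      let ?G1 = "contract G y z" and ?K1 = "K - {z}"
      have zX: "z \<notin> X"
        using edge K by auto
      have pG1: "pair_graph ?G1"
        using G edge by (intro pair_graph_contract)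
      have nK1: "nbs ?G1 ?K1 = nbs G K"
        using nbs_contract[OF G edge(4), of ?K1] edge yz by (simp add: insert_absorb)
      have tor: "torso ?G1 ?K1 = torso G K"
      proof (rule pair_pre_digraph.equality)
        have "(u, v) \<in> parcs (torso ?G1 ?K1) \<longleftrightarrow> (u, v) \<in> parcs (torso G K)" for u v
          unfolding parcs_torso_iff nK1 parcs_contract_iff using edge yz sym by blast
        then show "parcs (torso ?G1 ?K1) = parcs (torso G K)"
          by auto
      qed (use edge in auto)
      have "rooted_minor X ?G1 (torso ?G1 ?K1)"
      proof (rule IH)
        show "card ?K1 < card K"
          using edge finK by (intro psubset_card_mono) auto
        show "pair_graph ?G1"
          by (rule pG1)
        show "X \<subseteq> pverts ?G1" "?K1 \<subseteq> pverts ?G1" "?K1 \<inter> X = {}" "?K1 \<noteq> {}"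
          using X K edge yz by auto
        show "card (nbs ?G1 ?K1) = 3"
          using nK1 T by simp
        show "2 \<le> card ?K1 \<or> (\<exists>s \<in> nbs ?G1 ?K1. \<exists>t \<in> nbs ?G1 ?K1. (s, t) \<in> parcs ?G1)"
          using edge finK by (intro disjI1) simp
        fix L assume L: "L \<subseteq> ?K1" "L \<noteq> {}"
        then have nL: "nbs ?G1 L = (if y \<in> L then nbs G (insert z L)
            else nbs G L - {z} \<union> (if z \<in> nbs G L then {y} else {}))"
          by (intro nbs_contract[OF G edge(4)]) auto
        show "3 \<le> card (nbs ?G1 L)"
        proof (cases "y \<in> L")
          case True
          then show ?thesis
            using nL L edge big[of "insert z L"] by auto
        next
          case yL: False
          have L3: "3 \<le> card (nbs G L)"
            using L big by blast
          show ?thesis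
          proof (cases "z \<in> nbs G L")
            case True
            have *: "nbs ?G1 L = insert y (nbs G L - {z})"
              using nL yL True by simp
            show ?thesis
            proof (cases "y \<in> nbs G L")
              case yN: True
              \<comment> \<open>Merging y and z costs L one neighbour. In this case no such set has
                exactly three neighbours with y and z among them, so at least three remain.\<close>
              have "card (nbs G L) \<noteq> 3"
                using False L yL True yN by blast
              then show ?thesis
                using * L3 True yN yz finite_nbs[OF G] by (simp add: insert_absorb)
            next
              case False
              then show ?thesis
                using * L3 True finite_nbs[OF G] by (simp add: card_insert_if)
            qed
          next
            case False
            then show ?thesis
              using nL yL L3 by simp
          qed
        qed
      qed
      then show ?thesis
        using rooted_minor_contract[OF G X edge(4) zX] tor rooted_minor_trans by metis
    qed
  next
    case indep
    obtain w where w: "w \<in> K"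
      using K by auto
    \<comment> \<open>Without arcs inside K, removing w leaves no new boundary; by size the boundary
      stays the same. Thus the torso of K arises from that of \<open>?K1\<close> by deleting
      w.\<close>
    let ?K1 = "K - {w}"
    have c1: "card ?K1 = card K - 1"
      using w finK by simp
    have "nbs G ?K1 \<subseteq> nbs G K"
      using indep w by (auto simp: nbs_iff)
    moreover have "?K1 \<noteq> {}"
      using c1 indep by fastforce
    moreover from this have "3 \<le> card (nbs G ?K1)"
      by (intro big) auto
    ultimately have n1: "nbs G ?K1 = nbs G K"
      using T finite_nbs[OF G] by (intro card_seteq) auto
    have "rooted_minor X G (torso G ?K1)"
    proof (rule IH[OF _ G X])
      show "card ?K1 < card K" "2 \<le> card ?K1 \<or> (\<exists>s \<in> nbs G ?K1. \<exists>t \<in> nbs G ?K1. (s, t) \<in> parcs G)"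
        using c1 indep by auto
      show "?K1 \<subseteq> pverts G" "?K1 \<inter> X = {}" "?K1 \<noteq> {}" "card (nbs G ?K1) = 3"
        using K n1 T \<open>?K1 \<noteq> {}\<close> by auto
      show "3 \<le> card (nbs G L)" if "L \<subseteq> ?K1" "L \<noteq> {}" for L
        using that big[of L] by auto
    qed
    then show ?thesis
    proof (rule rooted_minor_subgraph)
      show "parcs (torso G K) \<subseteq> parcs (torso G ?K1)"
        using n1 by (auto simp: parcs_torso_iff)
    qed (use G X K in \<open>auto intro: pair_graph_torso\<close>)
  qed
qed

section \<open>Vertices of degree three in critical graphs\<close>

text \<open>Isolates the facts about a smallest counterexample that the degree-three argument
  consumes: \<open>small\<close> records the failure of torso reductions, \<open>contract\<close>
  that of legal contractions.\<close>

locale critical =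
  fixes G :: "'a pair_pre_digraph" and X :: "'a set"
  assumes G: "pair_graph G" and X: "X \<subseteq> pverts G" and linked: "linked 4 G X"
    and small: "\<And>K. K \<noteq> {} \<Longrightarrow> K \<subseteq> pverts G \<Longrightarrow> K \<inter> X = {} \<Longrightarrow> card (nbs G K) \<le> 3 \<Longrightarrow>
      \<exists>w. K = {w} \<and> card (nbs G {w}) = 3 \<and> (\<forall>s \<in> nbs G {w}. \<forall>t \<in> nbs G {w}. (s, t) \<notin> parcs G)"
    and contract: "\<And>x y. (x, y) \<in> parcs G \<Longrightarrow> y \<notin> X \<Longrightarrow> \<not> linked 4 (contract G x y) X"
begin

text \<open>If K met X, linkedness would make K and B cover X. So \<open>small\<close> applies to a
  nonempty K, and N(K), having three vertices inside B, fills B.\<close>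

lemma corner_cases:
  assumes "K \<subseteq> pverts G" "nbs G K \<subseteq> B" "finite B" "card B \<le> 3" "\<not> X \<subseteq> K \<union> B"
  obtains "K = {}" | w where "K = {w}" "w \<notin> X" "nbs G {w} = B" "card B = 3"
    "\<And>s t. s \<in> B \<Longrightarrow> t \<in> B \<Longrightarrow> (s, t) \<notin> parcs G"
proof (cases "K = {}")
  case False
  have KX: "K \<inter> X = {}"
    using linked_cover[OF linked assms(1) _ assms(2,3)] assms(4,5) by fastforce
  have "card (nbs G K) \<le> 3"
    using assms card_mono le_trans by metis
  then obtain w where w: "K = {w}" "card (nbs G {w}) = 3"
    "\<forall>s \<in> nbs G {w}. \<forall>t \<in> nbs G {w}. (s, t) \<notin> parcs G"
    using small[OF False assms(1) KX] by blast
  moreover from this have "nbs G {w} = B"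
    using assms by (intro card_seteq) auto
  ultimately show ?thesis
    using that(2)[of w] KX by auto
qed (use that in blast)

text \<open>Otherwise linkedness puts X inside x and its neighbours, at most four vertices, whereas
  X has at least five.\<close>

lemma degree_ge_four:
  assumes "x \<in> X"
  shows "4 \<le> card (nbs G {x})"
proof (rule ccontr)
  assume A: "\<not> 4 \<le> card (nbs G {x})"
  then have "X \<subseteq> {x} \<union> nbs G {x}"
    using assms X finite_nbs[OF G] by (intro linked_cover[OF linked]) auto
  then have "card X \<le> card (insert x (nbs G {x}))"
    using finite_nbs[OF G] by (intro card_mono) auto
  also have "\<dots> \<le> Suc (card (nbs G {x}))"
    using finite_nbs[OF G] by (simp add: card_insert_if)
  finally show False
    using A linked by (simp add: linked_def)
qed

text \<open>The vertex v stays outside all three parts. If it is not in X, adding it to S gives a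
  separator of X in G with four vertices, the least number that linkedness permits.\<close>

definition sep :: "'a \<Rightarrow> 'a set \<Rightarrow> 'a set \<Rightarrow> 'a set \<Rightarrow> bool" where
  "sep v L S R \<longleftrightarrow> L \<union> S \<union> R = pverts G - {v} \<and> L \<inter> S = {} \<and> L \<inter> R = {} \<and> S \<inter> R = {} \<and>
     (\<forall>x \<in> L. \<forall>y \<in> R. (x, y) \<notin> parcs G) \<and> L \<inter> X \<noteq> {} \<and> R \<inter> X \<noteq> {} \<and> card S = 3"

lemma sep_sym: "sep v L S R \<Longrightarrow> sep v R S L"
  using parcs_sym[OF G] unfolding sep_def by blast

lemma sep_finite: "sep v L S R \<Longrightarrow> finite S"
  \<comment> \<open>Infinite sets have \<open>card\<close> 0, so a value of 3 entails
    finiteness.\<close>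
  unfolding sep_def using card.infinite by fastforce

text \<open>The separation witnesses that X is not linked after contracting the edge av.\<close>

lemma sep_exists:
  assumes v: "v \<in> pverts G" "v \<notin> X" and nv: "nbs G {v} = {a, b, c}"
  obtains L S R where "sep v L S R" "a \<in> S" "b \<in> L" "c \<in> R"
proof -
  have "a \<in> nbs G {v}" "b \<in> nbs G {v}" "c \<in> nbs G {v}"
    using nv by auto
  then have av: "(a, v) \<in> parcs G" and abc: "a \<noteq> v" "b \<noteq> v" "c \<noteq> v"
    "a \<in> pverts G" "b \<in> pverts G" "c \<in> pverts G"
    using parcs_sym[OF G] parcs_in_pverts[OF G] by (auto simp: nbs_iff)
  have Nv: "z \<in> {a, b, c}" if "(v, z) \<in> parcs G" for z
  proof -
    have "z \<in> nbs G {v}"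
      using that parcs_irrefl[OF G] by (auto simp: nbs_iff)
    then show ?thesis
      using nv by auto
  qed
  let ?H = "contract G a v"
  have "4 < card X" "\<not> linked 4 ?H X"
    using linked contract[OF av v(2)] by (auto simp: linked_def)
  then obtain A where A: "A \<subseteq> pverts ?H" "A \<inter> X \<noteq> {}" "\<not> X \<subseteq> A \<union> nbs ?H A"
    "\<not> 4 \<le> card (nbs ?H A)"
    unfolding linked_def by blast
  define S where "S = nbs ?H A"
  define R where "R = pverts G - {v} - A - S"
  have vA: "v \<notin> A"
    using A by auto
  have pH: "pair_graph ?H"
    using G av by (rule pair_graph_contract)
  have finS: "finite S"
    using pH finite_nbs by (auto simp: S_def)
  have SH: "S \<subseteq> pverts G - {v}" "S \<inter> A = {}"
    using nbs_in_pverts[OF pH, of A] by (auto simp: S_def nbs_iff)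
  have S: "S = (if a \<in> A then nbs G (insert v A) else nbs G A - {v} \<union> (if v \<in> nbs G A then {a} else {}))"
    unfolding S_def by (rule nbs_contract[OF G av vA])
  have no: "\<not> nbs G B \<subseteq> S" if "B = A \<or> B = insert v A" for B
  proof
    assume "nbs G B \<subseteq> S"
    then have "X \<subseteq> B \<union> S"
      using that A v finS by (intro linked_cover[OF linked]) (auto simp: S_def)
    then show False
      using that A v by (auto simp: S_def)
  qed
  \<comment> \<open>By \<open>nbs_contract\<close>, S would be N(A with v added) if a were in A, and
    N(A) if neither a were in A nor v in N(A). Both contradict \<open>no\<close>.\<close>
  have aA: "a \<notin> A"
    using no[of "insert v A"] S by auto
  have vN: "v \<in> nbs G A"
    using no[of A] S aA by auto
  have S': "S = insert a (nbs G A - {v})"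
    using S aA vN by simp
  then have NA: "nbs G A \<subseteq> insert v S"
    by auto
  obtain x where "x \<in> A" "(v, x) \<in> parcs G"
    using vN parcs_sym[OF G] by (auto simp: nbs_iff)
  then have inA: "b \<in> A \<or> c \<in> A"
    using Nv aA by auto
  \<comment> \<open>Otherwise all neighbours of v lie in A or S, and v could join A with its
    neighbourhood still inside S.\<close>
  have inR: "b \<in> R \<or> c \<in> R"
  proof (rule ccontr)
    assume "\<not> ?thesis"
    then have "b \<in> A \<union> S" "c \<in> A \<union> S"
      using abc by (auto simp: R_def)
    moreover have "a \<in> S"
      using S' by simp
    ultimately have "nbs G {v} \<subseteq> A \<union> S"
      using nv by auto
    moreover have "nbs G (insert v A) \<subseteq> (nbs G {v} - A) \<union> (nbs G A - {v})"
      by (auto simp: nbs_iff)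
    ultimately have "nbs G (insert v A) \<subseteq> S"
      using S' by auto
    then show False
      using no[of "insert v A"] by blast
  qed
  have RX: "R \<inter> X \<noteq> {}"
    using A(3) X v by (auto simp: R_def S_def)
  \<comment> \<open>With fewer than three vertices, S and v together would still be too small to
    separate X in G.\<close>
  have "card S = 3"
  proof (rule ccontr)
    assume "card S \<noteq> 3"
    then have "card (insert v S) < 4"
      using A(4) finS by (auto simp: S_def[symmetric] card_insert_if)
    then have "X \<subseteq> A \<union> insert v S"
      using A NA finS by (intro linked_cover[OF linked]) auto
    then show False
      using A(3) v by (auto simp: S_def)
  qed
  moreover have "(x, y) \<notin> parcs G" if "x \<in> A" "y \<in> R" for x y
  proof
    assume "(x, y) \<in> parcs G"
    then have "y \<in> nbs G A"
      using that by (auto simp: nbs_iff R_def)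
    then show False
      using NA that by (auto simp: R_def)
  qed
  moreover have "A \<union> S \<union> R = pverts G - {v}"
    using A SH by (auto simp: R_def)
  ultimately have sep: "sep v A S R"
    using A RX SH by (auto simp: sep_def R_def)
  have "a \<in> S"
    using S' by simp
  moreover have "A \<inter> R = {}"
    by (auto simp: R_def)
  \<comment> \<open>A and R are disjoint and each contains b or c; exchanging the sides if necessary
    puts b on the left.\<close>
  ultimately show ?thesis
    using inA inR that[of A S R] that[of R S A] sep sep_sym by blast
qed

lemma sep_no_arc: "sep v L S R \<Longrightarrow> x \<in> L \<Longrightarrow> (x, y) \<in> parcs G \<Longrightarrow> y \<notin> R"
  by (auto simp: sep_def)

lemma sep_cover: "sep v L S R \<Longrightarrow> z \<in> pverts G \<Longrightarrow> z = v \<or> z \<in> L \<or> z \<in> S \<or> z \<in> R"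
  by (auto simp: sep_def)

lemma sep_disjoint: "sep v L S R \<Longrightarrow> L \<inter> S = {} \<and> L \<inter> R = {} \<and> S \<inter> R = {}"
  by (simp add: sep_def)

lemma sep_subset:
  assumes "sep v L S R"
  shows "L \<subseteq> pverts G - {v}" "S \<subseteq> pverts G - {v}" "R \<subseteq> pverts G - {v}"
  using assms by (auto simp: sep_def)

lemma sep_partition:
  assumes "sep v L S R" "A \<subseteq> pverts G - {v}"
  shows "A = A \<inter> L \<union> A \<inter> S \<union> A \<inter> R"
proof -
  have "A \<subseteq> L \<union> S \<union> R"
    using assms by (simp add: sep_def)
  then show ?thesis
    by auto
qed

lemma sep_not_covered: "sep v L S R \<Longrightarrow> \<not> X \<subseteq> L \<union> S"
  by (auto simp: sep_def)

lemma nbs_sep_subset: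
  assumes s: "sep v L S R" and x: "x \<in> L"
  shows "nbs G {x} \<subseteq> insert v (L - {x} \<union> S)"
proof
  fix z assume "z \<in> nbs G {x}"
  then have "(x, z) \<in> parcs G" "z \<noteq> x"
    by (auto simp: nbs_iff)
  then show "z \<in> insert v (L - {x} \<union> S)"
    using sep_no_arc[OF s x] sep_cover[OF s] parcs_in_pverts[OF G] by blast
qed

section \<open>Corners of two separations and their boundaries\<close>

lemma nbs_corner:
  assumes s1: "sep v L1 S1 R1" and s2: "sep v L2 S2 R2"
  shows "nbs G (L1 \<inter> L2) \<subseteq> insert v (S1 \<inter> L2 \<union> S1 \<inter> S2 \<union> L1 \<inter> S2)"
proof
  fix z assume "z \<in> nbs G (L1 \<inter> L2)"
  then obtain y where y: "y \<in> L1" "y \<in> L2" "(y, z) \<in> parcs G" "\<not> (z \<in> L1 \<and> z \<in> L2)"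
    by (auto simp: nbs_iff)
  have z: "z \<in> pverts G"
    using parcs_in_pverts[OF G y(3)] by simp
  have "z \<notin> R1" "z \<notin> R2"
    using sep_no_arc[OF s1 y(1,3)] sep_no_arc[OF s2 y(2,3)] .
  then show "z \<in> insert v (S1 \<inter> L2 \<union> S1 \<inter> S2 \<union> L1 \<inter> S2)"
    using sep_cover[OF s1 z] sep_cover[OF s2 z] y(4) by blast
qed

lemma card_boundary:
  assumes "sep v L1 S1 R1" "sep v L2 S2 R2"
  shows "card (S1 \<inter> L2 \<union> S1 \<inter> S2 \<union> L1 \<inter> S2) = card (S1 \<inter> L2) + card (S1 \<inter> S2) + card (L1 \<inter> S2)"
proof -
  have fin: "finite S1" "finite S2"
    using assms sep_finite by auto
  have "card (S1 \<inter> L2 \<union> S1 \<inter> S2 \<union> L1 \<inter> S2) = card (S1 \<inter> L2 \<union> S1 \<inter> S2) + card (L1 \<inter> S2)"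
    using fin sep_disjoint[OF assms(1)] sep_disjoint[OF assms(2)] by (intro card_Un_disjoint) auto
  also have "card (S1 \<inter> L2 \<union> S1 \<inter> S2) = card (S1 \<inter> L2) + card (S1 \<inter> S2)"
    using fin sep_disjoint[OF assms(1)] sep_disjoint[OF assms(2)] by (intro card_Un_disjoint) auto
  finally show ?thesis .
qed

lemma card_separator:
  assumes "sep v L1 S1 R1" "sep v L2 S2 R2"
  shows "card (S1 \<inter> L2) + card (S1 \<inter> S2) + card (S1 \<inter> R2) = 3"
proof -
  have fin: "finite S1"
    using assms sep_finite by auto
  have "S1 \<inter> L2 \<union> S1 \<inter> S2 \<union> S1 \<inter> R2 = S1"
    using sep_partition[OF assms(2) sep_subset(2)[OF assms(1)]] by simp
  moreover have "card S1 = 3"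
    using assms(1) by (simp add: sep_def)
  ultimately have "3 = card (S1 \<inter> L2 \<union> S1 \<inter> S2 \<union> S1 \<inter> R2)"
    by simp
  also have "\<dots> = card (S1 \<inter> L2 \<union> S1 \<inter> S2) + card (S1 \<inter> R2)"
    using fin sep_disjoint[OF assms(1)] sep_disjoint[OF assms(2)] by (intro card_Un_disjoint) auto
  also have "card (S1 \<inter> L2 \<union> S1 \<inter> S2) = card (S1 \<inter> L2) + card (S1 \<inter> S2)"
    using fin sep_disjoint[OF assms(1)] sep_disjoint[OF assms(2)] by (intro card_Un_disjoint) auto
  finally show ?thesis
    by simp
qed

text \<open>A corner without neighbours of v does not have v in its boundary, so a count of at most
  three brings it within reach of \<open>corner_cases\<close>.\<close>

lemma small_corner_cases:
  assumes s1: "sep v L1 S1 R1" and s2: "sep v L2 S2 R2" and v: "nbs G {v} \<inter> (L1 \<inter> L2) = {}"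
    and c: "card (S1 \<inter> L2) + card (S1 \<inter> S2) + card (L1 \<inter> S2) \<le> 3"
  obtains "L1 \<inter> L2 = {}" | w where "L1 \<inter> L2 = {w}" "w \<notin> X"
    "card (S1 \<inter> L2) + card (S1 \<inter> S2) + card (L1 \<inter> S2) = 3"
    "\<And>s t. s \<in> S1 \<inter> L2 \<union> S1 \<inter> S2 \<union> L1 \<inter> S2 \<Longrightarrow> t \<in> S1 \<inter> L2 \<union> S1 \<inter> S2 \<union> L1 \<inter> S2 \<Longrightarrow>
      (s, t) \<notin> parcs G"
proof -
  note th = that
  let ?B = "S1 \<inter> L2 \<union> S1 \<inter> S2 \<union> L1 \<inter> S2"
  have V: "L1 \<inter> L2 \<subseteq> pverts G"
    using sep_subset[OF s1] by blast
  have "v \<notin> nbs G (L1 \<inter> L2)"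
  proof
    assume "v \<in> nbs G (L1 \<inter> L2)"
    then obtain y where "y \<in> L1 \<inter> L2" "(v, y) \<in> parcs G" "y \<noteq> v"
      using parcs_sym[OF G] by (auto simp: nbs_iff)
    then have "y \<in> nbs G {v} \<inter> (L1 \<inter> L2)"
      by (auto simp: nbs_iff)
    then show False
      using v by blast
  qed
  then have N: "nbs G (L1 \<inter> L2) \<subseteq> ?B"
    using nbs_corner[OF s1 s2] by blast
  have fin: "finite ?B"
    using s1 s2 sep_finite by auto
  have B: "card ?B \<le> 3"
    using card_boundary[OF s1 s2] c by simp
  have X: "\<not> X \<subseteq> L1 \<inter> L2 \<union> ?B"
    using sep_not_covered[OF s1] by blast
  show thesis
  proof (cases rule: corner_cases[OF V N fin B X])
    case 1
    then show ?thesis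
      by (rule th(1))
  next
    case (2 w)
    have "card (S1 \<inter> L2) + card (S1 \<inter> S2) + card (L1 \<inter> S2) = 3"
      using 2(4) card_boundary[OF s1 s2] by simp
    from th(2)[OF 2(1,2) this 2(5)] show ?thesis .
  qed
qed

text \<open>Here v may belong to the boundary and has to be counted, whence the bound 2 in place of
  3. The vertex c excludes the empty corner.\<close>

lemma far_corner:
  assumes s1: "sep v L1 S1 R1" and s2: "sep v L2 S2 R2" and v: "v \<in> pverts G" "v \<notin> X"
    and c: "c \<in> R1" "c \<in> R2"
    and card: "card (S1 \<inter> R2) + card (S1 \<inter> S2) + card (R1 \<inter> S2) \<le> 2"
  shows "R1 \<inter> R2 = {c}" "c \<notin> X"
    "card (S1 \<inter> R2) + card (S1 \<inter> S2) + card (R1 \<inter> S2) = 2"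
    "\<And>s t. s \<in> S1 \<inter> R2 \<union> S1 \<inter> S2 \<union> R1 \<inter> S2 \<Longrightarrow> t \<in> S1 \<inter> R2 \<union> S1 \<inter> S2 \<union> R1 \<inter> S2 \<Longrightarrow>
      (s, t) \<notin> parcs G"
proof -
  let ?B = "S1 \<inter> R2 \<union> S1 \<inter> S2 \<union> R1 \<inter> S2"
  note t1 = sep_sym[OF s1] and t2 = sep_sym[OF s2]
  have cB: "card ?B = card (S1 \<inter> R2) + card (S1 \<inter> S2) + card (R1 \<inter> S2)"
    by (rule card_boundary[OF t1 t2])
  have fB: "finite ?B"
    using s1 s2 sep_finite by auto
  have vB: "v \<notin> ?B"
    using sep_subset[OF s1] by blast
  have V: "R1 \<inter> R2 \<subseteq> pverts G"
    using sep_subset[OF s1] by blast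
  have cv: "card (insert v ?B) \<le> 3"
    using cB card vB fB by simp
  have X': "\<not> X \<subseteq> R1 \<inter> R2 \<union> insert v ?B"
    using sep_not_covered[OF t1] v by blast
  obtain w where w: "R1 \<inter> R2 = {w}" "w \<notin> X" "card (insert v ?B) = 3"
    and indep: "\<And>s t. s \<in> insert v ?B \<Longrightarrow> t \<in> insert v ?B \<Longrightarrow> (s, t) \<notin> parcs G"
  proof (cases rule: corner_cases[OF V nbs_corner[OF t1 t2] finite.insertI[OF fB] cv X'])
    case 1
    then show ?thesis
      using c by blast
  next
    case (2 w)
    show ?thesis
      by (rule that[OF 2(1,2,4,5)])
  qed
  have "c \<in> R1 \<inter> R2"
    using c by simp
  then have "w = c"
    unfolding w(1) by simp
  then show "R1 \<inter> R2 = {c}" "c \<notin> X"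
    using w by simp_all
  show "card (S1 \<inter> R2) + card (S1 \<inter> S2) + card (R1 \<inter> S2) = 2"
    using w(3) vB fB cB by simp
  show "(s, t) \<notin> parcs G" if "s \<in> ?B" "t \<in> ?B" for s t
    by (intro indep insertI2 that)
qed

text \<open>Besides b, the side \<open>L1\<close> consists of two corners, each with at most three
  boundary vertices. They avoid X, so b is in X because \<open>L1\<close> meets X; but b turns out
  to have at most three neighbours.\<close>

lemma no_single_side:
  assumes s1: "sep v L1 S1 R1" and s2: "sep v L2 S2 R2"
    and nv: "nbs G {v} = {a, b, c}" and ab: "(a, b) \<notin> parcs G"
    and 1: "a \<in> S1" "c \<in> R1" and 2: "a \<in> L2"
    and single: "L1 \<inter> S2 = {b}" and ne: "S1 \<inter> R2 \<noteq> {}"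
  shows False
proof -
  have fin: "finite S1"
    using s1 sep_finite by auto
  have S1: "S1 = S1 \<inter> L2 \<union> S1 \<inter> S2 \<union> S1 \<inter> R2"
    by (rule sep_partition[OF s2 sep_subset(2)[OF s1]])
  have L1: "L1 = L1 \<inter> L2 \<union> {b} \<union> L1 \<inter> R2"
    using sep_partition[OF s2 sep_subset(1)[OF s1]] single by simp
  have three: "card (S1 \<inter> L2) + card (S1 \<inter> S2) + card (S1 \<inter> R2) = 3"
    by (rule card_separator[OF s1 s2])
  have "S1 \<inter> L2 \<noteq> {}"
    using 1 2 by auto
  then have pos: "1 \<le> card (S1 \<inter> L2)" "1 \<le> card (S1 \<inter> R2)"
    using ne fin by (auto simp: Suc_le_eq card_gt_0_iff)
  have b1: "card (L1 \<inter> S2) = 1"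
    using single by simp
  have nvK: "nbs G {v} \<inter> (L1 \<inter> L2) = {}" "nbs G {v} \<inter> (L1 \<inter> R2) = {}"
  proof -
    have "b \<notin> L2" "b \<notin> R2"
      using single sep_disjoint[OF s2] by auto
    moreover have "a \<notin> L1" "c \<notin> L1"
      using 1 sep_disjoint[OF s1] by auto
    ultimately show "nbs G {v} \<inter> (L1 \<inter> L2) = {}" "nbs G {v} \<inter> (L1 \<inter> R2) = {}"
      using nv by auto
  qed
  have Nb: "nbs G {b} \<subseteq> {v} \<union> (S1 - {a}) \<union> (L1 \<inter> L2) \<union> (L1 \<inter> R2)"
  proof -
    have "b \<in> L1"
      using single by auto
    moreover have "a \<notin> nbs G {b}"
      using ab parcs_sym[OF G] by (auto simp: nbs_iff)
    moreover have "L1 - {b} \<subseteq> L1 \<inter> L2 \<union> L1 \<inter> R2"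
      by (subst L1) auto
    ultimately show ?thesis
      using nbs_sep_subset[OF s1, of b] by auto
  qed
  have indepb: "z \<notin> nbs G {b}" if "(b, z) \<notin> parcs G" for z
    using that by (auto simp: nbs_iff)
  have bB: "b \<in> L1 \<inter> S2"
    using single by simp
  have t2: "sep v R2 S2 L2"
    using s2 by (rule sep_sym)
  have bound: "card (nbs G {b}) \<le> card F" if "nbs G {b} \<subseteq> F" "finite F" for F
    using that card_mono by blast
  have c3: "card {x, y, z} \<le> 3" for x y z :: 'a
    by (simp add: card_insert_if)
  \<comment> \<open>A nonempty corner is one vertex whose boundary contains b and is independent, so
    b has no neighbours in that boundary. In each combination of empty and nonempty corners, at most
    two possible neighbours besides v are left.\<close>
  have "card (nbs G {b}) \<le> 3 \<and> b \<in> X"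
  proof (rule small_corner_cases[OF s1 s2 nvK(1)])
    show "card (S1 \<inter> L2) + card (S1 \<inter> S2) + card (L1 \<inter> S2) \<le> 3"
      using three pos b1 by linarith
  next
    assume K: "L1 \<inter> L2 = {}"
    show ?thesis
    proof (rule small_corner_cases[OF s1 t2 nvK(2)])
      show "card (S1 \<inter> R2) + card (S1 \<inter> S2) + card (L1 \<inter> S2) \<le> 3"
        using three pos b1 by linarith
    next
      assume K': "L1 \<inter> R2 = {}"
      have "card (nbs G {b}) \<le> card (insert v (S1 - {a}))"
        using Nb K K' fin by (intro bound) auto
      also have "\<dots> \<le> Suc (card (S1 - {a}))"
        using fin by (simp add: card_insert_if)
      also have "\<dots> = 3"
        using 1 s1 by (simp add: sep_def)
      finally show ?thesis
        using L1 K K' s1 by (auto simp: sep_def)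
    next
      fix w assume w: "L1 \<inter> R2 = {w}" "w \<notin> X"
        "card (S1 \<inter> R2) + card (S1 \<inter> S2) + card (L1 \<inter> S2) = 3"
        "\<And>s t. s \<in> S1 \<inter> R2 \<union> S1 \<inter> S2 \<union> L1 \<inter> S2 \<Longrightarrow> t \<in> S1 \<inter> R2 \<union> S1 \<inter> S2 \<union> L1 \<inter> S2 \<Longrightarrow>
          (s, t) \<notin> parcs G"
      have "card (S1 \<inter> L2) = 1"
        using w(3) b1 three by linarith
      then obtain u where u: "S1 \<inter> L2 = {u}"
        by (auto simp: card_1_singleton_iff)
      have "nbs G {b} \<subseteq> {v, w, u}"
        using Nb K w(1) S1 u w(4)[of b] bB indepb by blast
      then have "card (nbs G {b}) \<le> 3"
        using bound[of "{v, w, u}"] c3[of v w u] by auto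
      then show ?thesis
        using L1 K w s1 by (auto simp: sep_def)
    qed
  next
    fix w assume w: "L1 \<inter> L2 = {w}" "w \<notin> X"
      "card (S1 \<inter> L2) + card (S1 \<inter> S2) + card (L1 \<inter> S2) = 3"
      "\<And>s t. s \<in> S1 \<inter> L2 \<union> S1 \<inter> S2 \<union> L1 \<inter> S2 \<Longrightarrow> t \<in> S1 \<inter> L2 \<union> S1 \<inter> S2 \<union> L1 \<inter> S2 \<Longrightarrow>
        (s, t) \<notin> parcs G"
    have "card (S1 \<inter> R2) = 1"
      using w(3) b1 three by linarith
    then obtain u where u: "S1 \<inter> R2 = {u}"
      by (auto simp: card_1_singleton_iff)
    have Nb': "nbs G {b} \<subseteq> {v, w} \<union> (S1 \<inter> R2) \<union> (L1 \<inter> R2)"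
      using Nb w(1) S1 w(4)[of b] bB indepb by blast
    show ?thesis
    proof (rule small_corner_cases[OF s1 t2 nvK(2)])
      show "card (S1 \<inter> R2) + card (S1 \<inter> S2) + card (L1 \<inter> S2) \<le> 3"
        using three pos b1 by linarith
    next
      assume K': "L1 \<inter> R2 = {}"
      have "nbs G {b} \<subseteq> {v, w, u}"
        using Nb' K' u by auto
      then have "card (nbs G {b}) \<le> 3"
        using bound[of "{v, w, u}"] c3[of v w u] by auto
      then show ?thesis
        using L1 K' w s1 by (auto simp: sep_def)
    next
      fix w' assume w': "L1 \<inter> R2 = {w'}" "w' \<notin> X"
        "\<And>s t. s \<in> S1 \<inter> R2 \<union> S1 \<inter> S2 \<union> L1 \<inter> S2 \<Longrightarrow> t \<in> S1 \<inter> R2 \<union> S1 \<inter> S2 \<union> L1 \<inter> S2 \<Longrightarrow>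
          (s, t) \<notin> parcs G"
      have "nbs G {b} \<subseteq> {v, w, w'}"
        using Nb' w'(1) w'(3)[of b] bB indepb by blast
      then have "card (nbs G {b}) \<le> 3"
        using bound[of "{v, w, w'}"] c3[of v w w'] by auto
      then show ?thesis
        using L1 w w' s1 by (auto simp: sep_def)
    qed
  qed
  then show False
    using degree_ge_four[of b] by linarith
qed

text \<open>With \<open>S1\<close> missing \<open>R2\<close>, the side \<open>R2\<close> consists of
  two corners. The far one is c alone, outside X; the boundary of the other lies in
  \<open>S2\<close>, so it avoids X as well. Then \<open>R2\<close> cannot meet X.\<close>

lemma no_far_side:
  assumes s1: "sep v L1 S1 R1" and s2: "sep v L2 S2 R2" and v: "v \<in> pverts G" "v \<notin> X"
    and nv: "nbs G {v} = {a, b, c}" and 1: "a \<in> S1" "b \<in> S2" and c: "c \<in> R1" "c \<in> R2"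
    and card: "card (S1 \<inter> S2) + card (R1 \<inter> S2) \<le> 2" and ne: "S1 \<inter> R2 = {}"
  shows False
proof -
  have far: "R1 \<inter> R2 = {c}" "c \<notin> X"
    using far_corner[OF s1 s2 v c] card ne by auto
  from card_separator[OF s2 s1] have "card (S1 \<inter> R2) + card (S1 \<inter> S2) + card (L1 \<inter> S2) \<le> 3"
    using ne by (simp add: Int_commute)
  then have le: "card (S1 \<inter> R2) + card (S1 \<inter> S2) + card (L1 \<inter> S2) \<le> 3" .
  have nvK: "nbs G {v} \<inter> (L1 \<inter> R2) = {}"
    using nv 1 c sep_disjoint[OF s1] sep_disjoint[OF s2] by auto
  have "L1 \<inter> R2 \<inter> X = {}"
    by (rule small_corner_cases[OF s1 sep_sym[OF s2] nvK le]) auto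
  moreover have "R2 = R2 \<inter> L1 \<union> R2 \<inter> S1 \<union> R2 \<inter> R1"
    by (rule sep_partition[OF s1 sep_subset(3)[OF s2]])
  then have "R2 \<subseteq> (L1 \<inter> R2) \<union> {c}"
    using far(1) ne by auto
  ultimately have "R2 \<inter> X = {}"
    using far(2) by blast
  then show False
    using s2 by (simp add: sep_def)
qed

text \<open>The side \<open>R1\<close> consists of c, the single vertex d of \<open>S2\<close> in
  it, and a corner bounded by three vertices. As c and the corner avoid X, d is in X. But d is
  adjacent neither to v nor to the vertex q of \<open>S1\<close> in \<open>R2\<close>, and
  independence of the corner boundary leaves d at most three neighbours.\<close>

lemma no_far_edge:
  assumes s1: "sep v L1 S1 R1" and s2: "sep v L2 S2 R2" and v: "v \<in> pverts G" "v \<notin> X"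
    and nv: "nbs G {v} = {a, b, c}" and 1: "a \<in> S1" "b \<in> L1" and c: "c \<in> R1" "c \<in> R2"
    and card: "S1 \<inter> S2 = {}" "card (S1 \<inter> R2) = 1" "card (R1 \<inter> S2) = 1"
  shows False
proof -
  obtain q d where q: "S1 \<inter> R2 = {q}" and d: "R1 \<inter> S2 = {d}"
    using card by (auto simp: card_1_singleton_iff)
  note far = far_corner[OF s1 s2 v c]
  have R: "R1 \<inter> R2 = {c}" "c \<notin> X" and dq: "(d, q) \<notin> parcs G"
    using far(1,2) far(4)[of d q] card q d by auto
  have three: "card (S1 \<inter> L2) = 2"
    using card_separator[OF s1 s2] card by simp
  have S1: "S1 \<subseteq> insert q (S1 \<inter> L2)"
    using equalityD1[OF sep_partition[OF s2 sep_subset(2)[OF s1]]] unfolding card(1) q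
    by (rule subset_trans) auto
  have R1: "R1 \<subseteq> insert d (insert c (R1 \<inter> L2))"
    using equalityD1[OF sep_partition[OF s2 sep_subset(3)[OF s1]]] unfolding d R(1)
    by (rule subset_trans) auto
  have dR: "d \<in> R1" "d \<in> S2"
    using d by auto
  have "d \<notin> {a, b, c}"
    using dR 1 c sep_disjoint[OF s1] sep_disjoint[OF s2] by auto
  then have "v \<notin> nbs G {d}"
    using nv parcs_sym[OF G] parcs_irrefl[OF G] by (auto simp: nbs_iff)
  moreover have "q \<notin> nbs G {d}"
    using dq by (auto simp: nbs_iff)
  moreover have "d \<notin> nbs G {d}"
    by (simp add: nbs_iff)
  moreover have "nbs G {d} \<subseteq> insert v (insert q (S1 \<inter> L2) \<union> insert d (insert c (R1 \<inter> L2)))"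
  proof -
    have "insert v (R1 - {d} \<union> S1) \<subseteq> insert v (insert q (S1 \<inter> L2) \<union> insert d (insert c (R1 \<inter> L2)))"
      using Un_mono[OF S1 R1] by auto
    then show ?thesis
      using nbs_sep_subset[OF sep_sym[OF s1] dR(1)] by (rule subset_trans[rotated])
  qed
  ultimately have Nd: "nbs G {d} \<subseteq> insert c (S1 \<inter> L2 \<union> R1 \<inter> L2)"
    by blast
  have fin: "finite S1"
    using s1 sep_finite by auto
  have nvK: "nbs G {v} \<inter> (R1 \<inter> L2) = {}"
    using nv 1 c sep_disjoint[OF s1] sep_disjoint[OF s2] by auto
  have "card (nbs G {d}) \<le> 3 \<and> d \<in> X"
  proof (rule small_corner_cases[OF sep_sym[OF s1] s2 nvK])
    show "card (S1 \<inter> L2) + card (S1 \<inter> S2) + card (R1 \<inter> S2) \<le> 3"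
      using three card by simp
  next
    assume K: "R1 \<inter> L2 = {}"
    have "card (nbs G {d}) \<le> card (insert c (S1 \<inter> L2))"
      using Nd K fin by (intro card_mono) auto
    also have "\<dots> \<le> 3"
      using three fin by (simp add: card_insert_if)
    finally show ?thesis
      using K R1 R s1 by (auto simp: sep_def)
  next
    fix w assume w: "R1 \<inter> L2 = {w}" "w \<notin> X"
      "\<And>s t. s \<in> S1 \<inter> L2 \<union> S1 \<inter> S2 \<union> R1 \<inter> S2 \<Longrightarrow> t \<in> S1 \<inter> L2 \<union> S1 \<inter> S2 \<union> R1 \<inter> S2 \<Longrightarrow>
        (s, t) \<notin> parcs G"
    have "(d, t) \<notin> parcs G" if "t \<in> S1 \<inter> L2" for t
      using w(3)[of d t] that dR by auto
    then have "nbs G {d} \<subseteq> {c, w}"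
      using Nd w(1) by (auto simp: nbs_iff)
    then have "card (nbs G {d}) \<le> card {c, w}"
      by (intro card_mono) auto
    also have "\<dots> \<le> 3"
      by (simp add: card_insert_if)
    finally show ?thesis
      using w R1 R s1 by (auto simp: sep_def)
  qed
  then show False
    using degree_ge_four[of d] by linarith
qed

text \<open>One separation comes from contracting av, the other from contracting bv. Everything
  reduces to the sizes of the pieces into which each separation cuts the separator of the
  other.\<close>

lemma no_degree_three:
  assumes v: "v \<in> pverts G" "v \<notin> X" and card: "card (nbs G {v}) = 3"
  shows False
proof -
  obtain w where w: "{v} = {w}" "\<forall>s \<in> nbs G {w}. \<forall>t \<in> nbs G {w}. (s, t) \<notin> parcs G"
    using small[of "{v}"] v card by auto
  obtain a b c where nv: "nbs G {v} = {a, b, c}" and "a \<noteq> b" "a \<noteq> c" "b \<noteq> c"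
    using card by (auto simp: card_3_iff)
  then have nv': "nbs G {v} = {b, a, c}"
    by auto
  have ab: "(a, b) \<notin> parcs G" "(b, a) \<notin> parcs G"
    using w nv by auto
  obtain L1 S1 R1 where s1: "sep v L1 S1 R1" "a \<in> S1" "b \<in> L1" "c \<in> R1"
    using sep_exists[OF v nv] by blast
  obtain L2 S2 R2 where s2: "sep v L2 S2 R2" "b \<in> S2" "a \<in> L2" "c \<in> R2"
    using sep_exists[OF v nv'] by blast
  have fin: "finite S1" "finite S2"
    using s1 s2 sep_finite by auto
  define s l1 l2 r1 r2 where "s = card (S1 \<inter> S2)" and "l1 = card (L1 \<inter> S2)"
    and "l2 = card (S1 \<inter> L2)" and "r1 = card (R1 \<inter> S2)" and "r2 = card (S1 \<inter> R2)"
  note defs = s_def l1_def l2_def r1_def r2_def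
  have e1: "l2 + s + r2 = 3"
    using card_separator[OF s1(1) s2(1)] by (simp add: defs)
  have e2: "l1 + s + r1 = 3"
    using card_separator[OF s2(1) s1(1)] by (simp add: defs Int_commute)
  have z: "r1 = 0 \<longleftrightarrow> R1 \<inter> S2 = {}" "r2 = 0 \<longleftrightarrow> S1 \<inter> R2 = {}" "s = 0 \<longleftrightarrow> S1 \<inter> S2 = {}"
    "l1 = 0 \<longleftrightarrow> L1 \<inter> S2 = {}" "l2 = 0 \<longleftrightarrow> S1 \<inter> L2 = {}"
    using fin by (auto simp: defs)
  have pos: "l1 \<noteq> 0" "l2 \<noteq> 0"
    using z s1 s2 by auto
  have two: "2 \<le> s + r1 + r2"
    using far_corner(3)[OF s1(1) s2(1) v s1(4) s2(4)] unfolding defs by linarith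
  have single1: "\<not> (l1 = 1 \<and> r2 \<noteq> 0)"
  proof
    assume A: "l1 = 1 \<and> r2 \<noteq> 0"
    then have "L1 \<inter> S2 = {b}"
      using s1(3) s2(2) unfolding l1_def by (metis IntI card_1_singletonE singletonD)
    then show False
      using no_single_side[OF s1(1) s2(1) nv ab(1) s1(2,4) s2(3)] A z by blast
  qed
  have single2: "\<not> (l2 = 1 \<and> r1 \<noteq> 0)"
  proof
    assume A: "l2 = 1 \<and> r1 \<noteq> 0"
    then have "L2 \<inter> S1 = {a}"
      using s1(2) s2(3) unfolding l2_def by (metis IntI Int_commute card_1_singletonE singletonD)
    moreover have "S2 \<inter> R1 \<noteq> {}"
      using A z(1) by (auto simp: Int_commute)
    ultimately show False
      using no_single_side[OF s2(1) s1(1) nv' ab(2) s2(2,4) s1(3)] by blast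
  qed
  have far1: "\<not> (s + r1 + r2 = 2 \<and> r2 = 0)"
    using no_far_side[OF s1(1) s2(1) v nv s1(2) s2(2) s1(4) s2(4)] z(2) by (auto simp: defs)
  have far2: "\<not> (s + r1 + r2 = 2 \<and> r1 = 0)"
    using no_far_side[OF s2(1) s1(1) v nv' s2(2) s1(2) s2(4) s1(4)] z(1)
    by (auto simp: defs Int_commute)
  have edge: "\<not> (s = 0 \<and> r1 = 1 \<and> r2 = 1)"
    using no_far_edge[OF s1(1) s2(1) v nv s1(2,3,4) s2(4)] z(3) by (auto simp: defs)
  \<comment> \<open>The sum s + r1 + r2 is at least 3, since 2 would leave only the excluded s = 0,
    r1 = r2 = 1. By \<open>e1\<close> and \<open>e2\<close>, l2 <= r1 and l1 <= r2, so r1 and r2 are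
    positive and \<open>single1\<close>, \<open>single2\<close> force l1, l2 >= 2. Then s + r1 and s
    + r2 are at most 1, so the sum is only 2.\<close>
  show False
    using e1 e2 pos two single1 single2 far1 far2 edge by presburger
qed

end

section \<open>Four-connected rooted minors\<close>

text \<open>In a smallest counterexample no linked rooted minor is smaller than G, which makes G
  \<open>critical\<close>. A set witnessing that G is not 4-connected is then a single vertex of
  degree three, against \<open>no_degree_three\<close>.\<close>

lemma four_linked_rooted_minor:
  assumes "pair_graph G" "X \<subseteq> pverts G" "linked 4 G X"
  shows "\<exists>M. rooted_minor X G M \<and> linked 4 M (pverts M)"
  using assms
proof (induct G rule: pair_graph_size_induct)
  case (less G)
  note G = less.prems(1) and X = less.prems(2) and l = less.prems(3)
  show ?case
  proof (rule ccontr)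
    assume none: "\<not> ?thesis"
    have min: "\<not> (card (pverts M) < card (pverts G) \<or>
        pverts M = pverts G \<and> card (parcs M) < card (parcs G))"
      if "rooted_minor X G M" "linked 4 M X" for M
      using less.hyps[of M] that none rooted_minor_pair_graph rooted_minor_trans by blast
    have nk: "\<not> linked 4 G (pverts G)"
      using none rooted_minor_refl[OF G X] by blast
    have minsub: "H = G" if H: "pair_graph H" "pverts H \<subseteq> pverts G" "parcs H \<subseteq> parcs G"
        "X \<subseteq> pverts H" "linked 4 H X" for H
      using min[OF rooted_minor_of_subgraph[OF G H(1-4)] H(5)] smaller_subgraph[OF G H(2,3)] by blast
    have mintor: "\<not> rooted_minor X G (torso G K)" if "K \<noteq> {}" "K \<subseteq> pverts G" "K \<inter> X = {}" for K
    proof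
      assume "rooted_minor X G (torso G K)"
      moreover have "card (pverts G - K) < card (pverts G)"
        using that finite_pverts[OF G] by (intro psubset_card_mono) auto
      ultimately show False
        using min linked_torso[OF G l] that by fastforce
    qed
    have mincon: "\<not> linked 4 (contract G x y) X" if "(x, y) \<in> parcs G" "y \<notin> X" for x y
    proof
      assume "linked 4 (contract G x y) X"
      moreover have "card (pverts G - {y}) < card (pverts G)"
        using that parcs_in_pverts[OF G] finite_pverts[OF G] by (intro psubset_card_mono) auto
      ultimately show False
        using min rooted_minor_contract[OF G X that] by fastforce
    qed
    \<comment> \<open>Fewer than three neighbours would yield a suppressible vertex; its contraction
      equals its torso and is linked, against \<open>mincon\<close>.\<close>
    have three: "3 \<le> card (nbs G K)" if K: "K \<noteq> {}" "K \<subseteq> pverts G" "K \<inter> X = {}" for K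
    proof (rule ccontr)
      assume "\<not> ?thesis"
      then have "card (nbs G K) \<le> 2"
        by simp
      then obtain y a b where y: "y \<in> pverts G" "y \<notin> X" "a \<noteq> b" "nbs G {y} = {a, b}"
        "(a, b) \<notin> parcs G"
        using suppressible_vertex[OF G X l minsub K] by blast
      then show False
        using contract_two_nbs[OF G y(3,4)] mincon[of a y] linked_torso[OF G l, of "{y}"] by auto
    qed
    have "critical G X"
    proof (rule critical.intro[OF G X l _ mincon])
      fix K assume K: "K \<noteq> {}" "K \<subseteq> pverts G" "K \<inter> X = {}" "card (nbs G K) \<le> 3"
      have "card (nbs G K) = 3"
        using three[OF K(1-3)] K(4) by simp
      moreover have "3 \<le> card (nbs G K')" if "K' \<subseteq> K" "K' \<noteq> {}" for K'
        using three[of K'] that K by blast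
      ultimately have no: "\<not> (2 \<le> card K \<or> (\<exists>s \<in> nbs G K. \<exists>t \<in> nbs G K. (s, t) \<in> parcs G))"
        using rooted_minor_torso_three[OF G X K(2,3,1)] mintor[OF K(1-3)] by blast
      have "finite K"
        using K finite_pverts[OF G] finite_subset by blast
      then have "card K = 1"
        using no K(1) by (metis One_nat_def card_0_eq less_2_cases not_le)
      then obtain w where "K = {w}"
        by (auto simp: card_1_singleton_iff)
      then show "\<exists>w. K = {w} \<and> card (nbs G {w}) = 3 \<and>
          (\<forall>s \<in> nbs G {w}. \<forall>t \<in> nbs G {w}. (s, t) \<notin> parcs G)"
        using no \<open>card (nbs G K) = 3\<close> by blast
    qed
    then interpret critical G X .
    obtain K where K: "K \<noteq> {}" "K \<subseteq> pverts G" "K \<inter> X = {}" "card (nbs G K) < 4"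
      using not_linked_pverts_obtains[OF G X l nk] by blast
    then obtain w where "K = {w}" "card (nbs G {w}) = 3"
      using small[of K] by auto
    then show False
      using no_degree_three[of w] K by auto
  qed
qed

theorem theorem3:
  fixes G :: "'a pair_pre_digraph" and X :: "'a set" and k :: nat
  assumes "k \<in> {1, 2, 3, 4}"
    and "pair_graph G"
    and "X \<subseteq> pverts G"
    and "int k \<le> kappa G X"
  shows "(\<exists>M. rooted_minor X G M \<and> k_connected k M) \<and>
    (1 \<le> k \<and> k \<le> 3 \<longrightarrow> (\<exists>M. topological_rooted_minor X G M \<and> k_connected k M))"
proof -
  have l: "linked k G X"
    using assms by (simp add: linked_iff_kappa)
  have kc: "k_connected k M" if "rooted_minor X G M" "linked k M (pverts M)" for M
    using that rooted_minor_pair_graph by (auto simp: k_connected_def linked_iff_kappa)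
  have top: "\<exists>M. topological_rooted_minor X G M \<and> k_connected k M" if "k \<le> 3"
    using topological_rooted_minor_exists[OF assms(2,3) l that] topological_rooted_minorI assms(2) kc
    by metis
  show ?thesis
  proof (cases "k = 4")
    case True
    then show ?thesis
      using four_linked_rooted_minor[OF assms(2,3)] l kc by auto
  next
    case False
    \<comment> \<open>For k at most 3, part (i) is read off from part (ii), a topological rooted
      minor being a rooted minor.\<close>
    then have "k \<le> 3"
      using assms(1) by auto
    then show ?thesis
      using top by (auto simp: topological_rooted_minor_def)
  qed
qed

end
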